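(* Let $\Sigma$ be a subset of the axioms $\{\mathbf W,\mathbf C,\mathbf N,\mathbf T,\mathbf S,\mathbf U,\mathbf A\}$. For all subsets $\Gamma\cup\{\varphi\}\subseteq Fm_{\mathcal L}$: $\Gamma\vdash_{\mathbf{GV\Sigma}}\varphi\Leftrightarrow\Gamma\models_{\mathsf K_\Sigma,g}\varphi$, and $\Gamma\vdash_{\mathbf{LV\Sigma}}\varphi\Leftrightarrow\Gamma\models_{\mathsf K_\Sigma,l}\varphi$.
   Context: $\mathcal L$ is the language $\{\land,\lor,\to,0,1\}$ expanded with a binary counterfactual connective $\mathbin{\Box\!\!\rightarrow}$; $\neg x:=x\to0$. Base axioms: classical axioms, (L1) $\varphi\mathbin{\Box\!\!\rightarrow}\varphi$, (L2) $((\varphi\mathbin{\Box\!\!\rightarrow}\psi)\wedge(\psi\mathbin{\Box\!\!\rightarrow}\varphi))\to((\varphi\mathbin{\Box\!\!\rightarrow}\gamma)\leftrightarrow(\psi\mathbin{\Box\!\!\rightarrow}\gamma))$, (L3) $((\varphi\vee\psi)\mathbin{\Box\!\!\rightarrow}\varphi)\vee((\varphi\vee\psi)\mathbin{\Box\!\!\rightarrow}\psi)\vee(((\varphi\vee\psi)\mathbin{\Box\!\!\rightarrow}\gamma)\leftrightarrow((\varphi\mathbin{\Box\!\!\rightarrow}\gamma)\wedge(\psi\mathbin{\Box\!\!\rightarrow}\gamma)))$, (L4) $(\varphi\mathbin{\Box\!\!\rightarrow}(\psi\land\gamma))\leftrightarrow((\varphi\mathbin{\Box\!\!\rightarrow}\psi)\land(\varphi\mathbin{\Box\!\!\rightarrow}\gamma))$;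 $\mathbf{GV}$ is closed under modus ponens and (C) $\varphi\to\psi\vdash(\gamma\mathbin{\Box\!\!\rightarrow}\varphi)\to(\gamma\mathbin{\Box\!\!\rightarrow}\psi)$; $\mathbf{LV}$ under modus ponens and: if $\vdash\varphi\to\psi$ then $\vdash(\gamma\mathbin{\Box\!\!\rightarrow}\varphi)\to(\gamma\mathbin{\Box\!\!\rightarrow}\psi)$; $\mathbf{GV\Sigma}$, $\mathbf{LV\Sigma}$ are their axiomatic extensions by $\Sigma$. Derived connectives: $\varphi\mathbin{\Diamond\!\!\rightarrow}\psi:=\neg(\varphi\mathbin{\Box\!\!\rightarrow}\neg\psi)$, $\Box\varphi:=\neg\varphi\mathbin{\Box\!\!\rightarrow}\varphi$, $\Diamond\varphi:=\neg\Box\neg\varphi$, $\varphi\preccurlyeq\psi:=((\varphi\vee\psi)\mathbin{\Diamond\!\!\rightarrow}(\varphi\vee\psi))\to((\varphi\vee\psi)\mathbin{\Diamond\!\!\rightarrow}\varphi)$, $\varphi\prec\psi:=\neg(\psi\preccurlyeq\varphi)$. Axioms: ($\mathbf W$) $(\varphi\mathbin{\Box\!\!\rightarrow}\psi)\to(\varphi\to\psi)$; ($\mathbf C$) $((\varphi\mathbin{\Box\!\!\rightarrow}\psi)\to(\varphi\to\psi))\wedge(\varphi\wedge\psi)\to(\varphi\mathbin{\Box\!\!\rightarrow}\psi)$; ($\mathbf N$) $\Box\varphi\to\Diamond\varphi$; ($\mathbf T$) $\Box\varphi\to\varphi$; ($\mathbf S$) $(\varphi\mathbin{\Box\!\!\rightarrow}\psi)\vee(\varphi\mathbin{\Box\!\!\rightarrow}\neg\psi)$;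 ($\mathbf U$) $(\Diamond\varphi\to\Box\Diamond\varphi)\wedge(\Box\varphi\to\Box\Box\varphi)$; ($\mathbf A$) $((\varphi\preccurlyeq\psi)\to\Box(\varphi\preccurlyeq\psi))\wedge((\varphi\prec\psi)\to\Box(\varphi\prec\psi))$. A sphere model is $(W,\mathcal S,v)$ with each $\mathcal S(w)$ a family of nonempty nested subsets of $W$, $v$ extended classically and by $v(\varphi\mathbin{\Box\!\!\rightarrow}\psi)=\{w:\bigcup\mathcal S(w)\cap v(\varphi)=\emptyset$ or $\exists S\in\mathcal S(w)$, $\emptyset\neq S\cap v(\varphi)\subseteq v(\psi)\}$. $\mathsf K_\Sigma$ is the class of sphere models satisfying, for each axiom in $\Sigma$: ($\mathbf N$) $\bigcup\mathcal S(w)\neq\emptyset$; ($\mathbf T$) $w\in\bigcup\mathcal S(w)$; ($\mathbf W$) $\mathcal S(w)$ contains a nonempty sphere and $w$ lies in each nonempty sphere of $\mathcal S(w)$; ($\mathbf C$) $\{w\}\in\mathcal S(w)$; ($\mathbf S$) for every $w$ and formula $\varphi$ with $v(\varphi)\cap\bigcup\mathcal S(w)\neq\emptyset$ there are $X\in\mathcal S(w)$, $y$ with $v(\varphi)\cap X=\{y\}$; ($\mathbf U$) $\bigcup\mathcal S(w)=\bigcup\mathcal S(u)$ for all $w,u$; ($\mathbf A$) $\mathcal S(w)=\mathcal S(u)$ for all $w,u$. $\models_{\mathsf K,g}$: over models in $\mathsf K$, truth of $\Gamma$ at all worlds implies truth of $\varphi$ at all worlds; $\models_{\mathsf K,l}$: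 truth of $\Gamma$ at a world implies truth of $\varphi$ at that world.
   Formalization: Axiom (C) is taken as the conjunction of (φ□→ψ)→(φ→ψ) and (φ∧ψ)→(φ□→ψ); read as a single implication, as printed, it holds at worlds without spheres and completeness fails for Σ={C}. *)

theory Defs
  imports Main
begin

section \<open>Syntax\<close>

text \<open>The propositional variables are the elements of an arbitrary type \<open>'p\<close>.\<close>

datatype 'p form =
    Var 'p
  | Conj "'p form" "'p form"  (infixr "\<^bold>\<and>" 65)
  | Disj "'p form" "'p form"  (infixr "\<^bold>\<or>" 60)
  | Impl "'p form" "'p form"  (infixr "\<^bold>\<rightarrow>" 55)
  | Zero  ("\<^bold>0")
  | One  ("\<^bold>1")
  | Would "'p form" "'p form"  (infix "\<box>\<rightarrow>" 70)

abbreviation Neg :: "'p form \<Rightarrow> 'p form"  ("\<^bold>\<not> _" [75] 75)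
  where "\<^bold>\<not> \<phi> \<equiv> \<phi> \<^bold>\<rightarrow> \<^bold>0"

abbreviation Iff :: "'p form \<Rightarrow> 'p form \<Rightarrow> 'p form"  (infixr "\<^bold>\<leftrightarrow>" 55)
  where "\<phi> \<^bold>\<leftrightarrow> \<psi> \<equiv> (\<phi> \<^bold>\<rightarrow> \<psi>) \<^bold>\<and> (\<psi> \<^bold>\<rightarrow> \<phi>)"

abbreviation Might :: "'p form \<Rightarrow> 'p form \<Rightarrow> 'p form"  (infix "\<diamond>\<rightarrow>" 70)
  where "\<phi> \<diamond>\<rightarrow> \<psi> \<equiv> \<^bold>\<not> (\<phi> \<box>\<rightarrow> (\<^bold>\<not> \<psi>))"

abbreviation Box :: "'p form \<Rightarrow> 'p form"  ("\<box> _" [75] 75)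
  where "\<box> \<phi> \<equiv> (\<^bold>\<not> \<phi>) \<box>\<rightarrow> \<phi>"

abbreviation Diamond :: "'p form \<Rightarrow> 'p form"  ("\<diamond> _" [75] 75)
  where "\<diamond> \<phi> \<equiv> \<^bold>\<not> (\<box> (\<^bold>\<not> \<phi>))"

abbreviation Preceq :: "'p form \<Rightarrow> 'p form \<Rightarrow> 'p form"  (infix "\<^bold>\<preceq>" 70)
  where "\<phi> \<^bold>\<preceq> \<psi> \<equiv> ((\<phi> \<^bold>\<or> \<psi>) \<diamond>\<rightarrow> (\<phi> \<^bold>\<or> \<psi>)) \<^bold>\<rightarrow> ((\<phi> \<^bold>\<or> \<psi>) \<diamond>\<rightarrow> \<phi>)"

abbreviation Prec :: "'p form \<Rightarrow> 'p form \<Rightarrow> 'p form"  (infix "\<^bold>\<prec>" 70)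
  where "\<phi> \<^bold>\<prec> \<psi> \<equiv> \<^bold>\<not> (\<psi> \<^bold>\<preceq> \<phi>)"


section \<open>The logics\<close>

inductive_set classical_axioms :: "'p form set" where
  "\<phi> \<^bold>\<rightarrow> (\<psi> \<^bold>\<rightarrow> \<phi>) \<in> classical_axioms"
| "(\<phi> \<^bold>\<rightarrow> (\<psi> \<^bold>\<rightarrow> \<gamma>)) \<^bold>\<rightarrow> ((\<phi> \<^bold>\<rightarrow> \<psi>) \<^bold>\<rightarrow> (\<phi> \<^bold>\<rightarrow> \<gamma>)) \<in> classical_axioms"
| "(\<phi> \<^bold>\<and> \<psi>) \<^bold>\<rightarrow> \<phi> \<in> classical_axioms"
| "(\<phi> \<^bold>\<and> \<psi>) \<^bold>\<rightarrow> \<psi> \<in> classical_axioms"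
| "\<phi> \<^bold>\<rightarrow> (\<psi> \<^bold>\<rightarrow> (\<phi> \<^bold>\<and> \<psi>)) \<in> classical_axioms"
| "\<phi> \<^bold>\<rightarrow> (\<phi> \<^bold>\<or> \<psi>) \<in> classical_axioms"
| "\<psi> \<^bold>\<rightarrow> (\<phi> \<^bold>\<or> \<psi>) \<in> classical_axioms"
| "(\<phi> \<^bold>\<rightarrow> \<gamma>) \<^bold>\<rightarrow> ((\<psi> \<^bold>\<rightarrow> \<gamma>) \<^bold>\<rightarrow> ((\<phi> \<^bold>\<or> \<psi>) \<^bold>\<rightarrow> \<gamma>)) \<in> classical_axioms"
| "\<^bold>0 \<^bold>\<rightarrow> \<phi> \<in> classical_axioms"
| "\<^bold>1 \<in> classical_axioms"
| "(\<^bold>\<not> (\<^bold>\<not> \<phi>)) \<^bold>\<rightarrow> \<phi> \<in> classical_axioms"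

inductive_set base_axioms :: "'p form set" where
  classical: "\<phi> \<in> classical_axioms \<Longrightarrow> \<phi> \<in> base_axioms"
| L1: "\<phi> \<box>\<rightarrow> \<phi> \<in> base_axioms"
| L2: "((\<phi> \<box>\<rightarrow> \<psi>) \<^bold>\<and> (\<psi> \<box>\<rightarrow> \<phi>)) \<^bold>\<rightarrow> ((\<phi> \<box>\<rightarrow> \<gamma>) \<^bold>\<leftrightarrow> (\<psi> \<box>\<rightarrow> \<gamma>)) \<in> base_axioms"
| L3: "((\<phi> \<^bold>\<or> \<psi>) \<box>\<rightarrow> \<phi>) \<^bold>\<or> ((\<phi> \<^bold>\<or> \<psi>) \<box>\<rightarrow> \<psi>) \<^bold>\<or>
        (((\<phi> \<^bold>\<or> \<psi>) \<box>\<rightarrow> \<gamma>) \<^bold>\<leftrightarrow> ((\<phi> \<box>\<rightarrow> \<gamma>) \<^bold>\<and> (\<psi> \<box>\<rightarrow> \<gamma>))) \<in> base_axioms"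
| L4: "(\<phi> \<box>\<rightarrow> (\<psi> \<^bold>\<and> \<gamma>)) \<^bold>\<leftrightarrow> ((\<phi> \<box>\<rightarrow> \<psi>) \<^bold>\<and> (\<phi> \<box>\<rightarrow> \<gamma>)) \<in> base_axioms"

datatype extra_axiom = AxW | AxC | AxN | AxT | AxS | AxU | AxA

text \<open>
  The scheme (C) is Lewis's centering axiom, the conjunction of weak centering (W) with
  \<open>(\<phi> \<^bold>\<and> \<psi>) \<^bold>\<rightarrow> (\<phi> \<box>\<rightarrow> \<psi>)\<close>. The variant in which a single implication
  to \<open>\<phi> \<box>\<rightarrow> \<psi>\<close> is the main connective would not entail (W): it holds
  wherever there are no spheres.
\<close>

fun instances :: "extra_axiom \<Rightarrow> 'p form set" where
  "instances AxW = {(\<phi> \<box>\<rightarrow> \<psi>) \<^bold>\<rightarrow> (\<phi> \<^bold>\<rightarrow> \<psi>) | \<phi> \<psi>. True}"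
| "instances AxC = {((\<phi> \<box>\<rightarrow> \<psi>) \<^bold>\<rightarrow> (\<phi> \<^bold>\<rightarrow> \<psi>)) \<^bold>\<and> ((\<phi> \<^bold>\<and> \<psi>) \<^bold>\<rightarrow> (\<phi> \<box>\<rightarrow> \<psi>)) | \<phi> \<psi>. True}"
| "instances AxN = {\<box> \<phi> \<^bold>\<rightarrow> \<diamond> \<phi> | \<phi>. True}"
| "instances AxT = {\<box> \<phi> \<^bold>\<rightarrow> \<phi> | \<phi>. True}"
| "instances AxS = {(\<phi> \<box>\<rightarrow> \<psi>) \<^bold>\<or> (\<phi> \<box>\<rightarrow> (\<^bold>\<not> \<psi>)) | \<phi> \<psi>. True}"
| "instances AxU = {(\<diamond> \<phi> \<^bold>\<rightarrow> \<box> (\<diamond> \<phi>)) \<^bold>\<and> (\<box> \<phi> \<^bold>\<rightarrow> \<box> (\<box> \<phi>)) | \<phi>. True}"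
| "instances AxA = {((\<phi> \<^bold>\<preceq> \<psi>) \<^bold>\<rightarrow> \<box> (\<phi> \<^bold>\<preceq> \<psi>)) \<^bold>\<and> ((\<phi> \<^bold>\<prec> \<psi>) \<^bold>\<rightarrow> \<box> (\<phi> \<^bold>\<prec> \<psi>)) | \<phi> \<psi>. True}"

definition axioms_of :: "extra_axiom set \<Rightarrow> 'p form set"
  where "axioms_of \<Sigma> = base_axioms \<union> (\<Union>a\<in>\<Sigma>. instances a)"

inductive GV :: "extra_axiom set \<Rightarrow> 'p form set \<Rightarrow> 'p form \<Rightarrow> bool"
  for \<Sigma> :: "extra_axiom set" and \<Gamma> :: "'p form set" where
  hyp: "\<phi> \<in> \<Gamma> \<Longrightarrow> GV \<Sigma> \<Gamma> \<phi>"
| ax: "\<phi> \<in> axioms_of \<Sigma> \<Longrightarrow> GV \<Sigma> \<Gamma> \<phi>"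
| mp: "GV \<Sigma> \<Gamma> (\<phi> \<^bold>\<rightarrow> \<psi>) \<Longrightarrow> GV \<Sigma> \<Gamma> \<phi> \<Longrightarrow> GV \<Sigma> \<Gamma> \<psi>"
| C: "GV \<Sigma> \<Gamma> (\<phi> \<^bold>\<rightarrow> \<psi>) \<Longrightarrow> GV \<Sigma> \<Gamma> ((\<gamma> \<box>\<rightarrow> \<phi>) \<^bold>\<rightarrow> (\<gamma> \<box>\<rightarrow> \<psi>))"

inductive LV :: "extra_axiom set \<Rightarrow> 'p form set \<Rightarrow> 'p form \<Rightarrow> bool"
  for \<Sigma> :: "extra_axiom set" where
  hyp: "\<phi> \<in> \<Gamma> \<Longrightarrow> LV \<Sigma> \<Gamma> \<phi>"
| ax: "\<phi> \<in> axioms_of \<Sigma> \<Longrightarrow> LV \<Sigma> \<Gamma> \<phi>"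
| mp: "LV \<Sigma> \<Gamma> (\<phi> \<^bold>\<rightarrow> \<psi>) \<Longrightarrow> LV \<Sigma> \<Gamma> \<phi> \<Longrightarrow> LV \<Sigma> \<Gamma> \<psi>"
| wC: "LV \<Sigma> {} (\<phi> \<^bold>\<rightarrow> \<psi>) \<Longrightarrow> LV \<Sigma> \<Gamma> ((\<gamma> \<box>\<rightarrow> \<phi>) \<^bold>\<rightarrow> (\<gamma> \<box>\<rightarrow> \<psi>))"


section \<open>Sphere models\<close>

record ('w, 'p) model =
  worlds :: "'w set"
  spheres :: "'w \<Rightarrow> 'w set set"
  val :: "'p \<Rightarrow> 'w set"

definition sphere_model :: "('w, 'p) model \<Rightarrow> bool" where
  "sphere_model M \<longleftrightarrow>
     (\<forall>p. val M p \<subseteq> worlds M) \<and>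
     (\<forall>w\<in>worlds M.
        (\<forall>X\<in>spheres M w. X \<noteq> {} \<and> X \<subseteq> worlds M) \<and>
        (\<forall>X\<in>spheres M w. \<forall>Y\<in>spheres M w. X \<subseteq> Y \<or> Y \<subseteq> X))"

primrec ext :: "('w, 'p) model \<Rightarrow> 'p form \<Rightarrow> 'w set" where
  "ext M (Var p) = val M p"
| "ext M (\<phi> \<^bold>\<and> \<psi>) = ext M \<phi> \<inter> ext M \<psi>"
| "ext M (\<phi> \<^bold>\<or> \<psi>) = ext M \<phi> \<union> ext M \<psi>"
| "ext M (\<phi> \<^bold>\<rightarrow> \<psi>) = (worlds M - ext M \<phi>) \<union> ext M \<psi>"
| "ext M \<^bold>0 = {}"
| "ext M \<^bold>1 = worlds M"
| "ext M (\<phi> \<box>\<rightarrow> \<psi>) =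
     {w \<in> worlds M. \<Union> (spheres M w) \<inter> ext M \<phi> = {} \<or>
        (\<exists>X\<in>spheres M w. X \<inter> ext M \<phi> \<noteq> {} \<and> X \<inter> ext M \<phi> \<subseteq> ext M \<psi>)}"

fun frame_condition :: "extra_axiom \<Rightarrow> ('w, 'p) model \<Rightarrow> bool" where
  "frame_condition AxW M \<longleftrightarrow>
     (\<forall>w\<in>worlds M. (\<exists>X\<in>spheres M w. X \<noteq> {}) \<and> (\<forall>X\<in>spheres M w. X \<noteq> {} \<longrightarrow> w \<in> X))"
| "frame_condition AxC M \<longleftrightarrow> (\<forall>w\<in>worlds M. {w} \<in> spheres M w)"
| "frame_condition AxN M \<longleftrightarrow> (\<forall>w\<in>worlds M. \<Union> (spheres M w) \<noteq> {})"
| "frame_condition AxT M \<longleftrightarrow> (\<forall>w\<in>worlds M. w \<in> \<Union> (spheres M w))"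
| "frame_condition AxS M \<longleftrightarrow>
     (\<forall>w\<in>worlds M. \<forall>\<phi>. ext M \<phi> \<inter> \<Union> (spheres M w) \<noteq> {} \<longrightarrow>
        (\<exists>X\<in>spheres M w. \<exists>y. ext M \<phi> \<inter> X = {y}))"
| "frame_condition AxU M \<longleftrightarrow>
     (\<forall>w\<in>worlds M. \<forall>u\<in>worlds M. \<Union> (spheres M w) = \<Union> (spheres M u))"
| "frame_condition AxA M \<longleftrightarrow>
     (\<forall>w\<in>worlds M. \<forall>u\<in>worlds M. spheres M w = spheres M u)"

definition K :: "extra_axiom set \<Rightarrow> ('w, 'p) model set"
  where "K \<Sigma> = {M. sphere_model M \<and> (\<forall>a\<in>\<Sigma>. frame_condition a M)}"

definition global_consequence :: "('w, 'p) model set \<Rightarrow> 'p form set \<Rightarrow> 'p form \<Rightarrow> bool" where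
  "global_consequence \<K> \<Gamma> \<phi> \<longleftrightarrow>
     (\<forall>M\<in>\<K>. (\<forall>\<gamma>\<in>\<Gamma>. \<forall>w\<in>worlds M. w \<in> ext M \<gamma>) \<longrightarrow> (\<forall>w\<in>worlds M. w \<in> ext M \<phi>))"

definition local_consequence :: "('w, 'p) model set \<Rightarrow> 'p form set \<Rightarrow> 'p form \<Rightarrow> bool" where
  "local_consequence \<K> \<Gamma> \<phi> \<longleftrightarrow>
     (\<forall>M\<in>\<K>. \<forall>w\<in>worlds M. (\<forall>\<gamma>\<in>\<Gamma>. w \<in> ext M \<gamma>) \<longrightarrow> w \<in> ext M \<phi>)"

text \<open>
  A proposition of HOL cannot quantify over all types of worlds, so the class of all sphere
  models is reached in two steps: consequence over the models whose worlds are drawn from the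
  type \<open>'p form set\<close> is to be equivalent to derivability, and derivability is to imply
  consequence over the models with worlds in an arbitrary type \<open>'w\<close>. Together these say
  that derivability is truth preservation over the models of all types. Equivalence
  for an arbitrary \<open>'w\<close> would be false: a type such as \<open>unit\<close> has too few worlds.
\<close>

end

theory Submission
  imports Defs
begin

text \<open>
  Completeness uses a canonical model whose worlds are maximal consistent sets. Around a world
  \<open>w\<close> every possible formula \<open>\<phi>\<close> determines the ideal of all formulas that are strictly less
  possible than \<open>\<phi>\<close>, and the sphere of \<open>\<phi>\<close> consists of the maximal consistent sets that avoid
  this ideal; it meets \<open>\<psi>\<close> exactly if \<open>\<psi>\<close> is at least as possible as \<open>\<phi>\<close>. The ideal of the
  impossible formulas yields one more, outermost, sphere. Without it the union of the spheres
  could miss worlds that contain formulas of unboundedly small possibility, and the conditions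
  for (T) and (U) could fail. The model is generated from a single point, so that
  the ideals of all worlds agree as soon as (U) or (A) transports them along accessibility.
\<close>

section \<open>Soundness\<close>

text \<open>The difficulty is to show, from (L1) to (L4) and monotonicity in the consequent, that
  the resulting ideals form a chain. Here (L3) matters twice: it yields the rule that joins
  antecedents, and it yields rational monotonicity, which narrows an antecedent to any formula that
  its closest worlds do not all refute. The former lifts a comparison to a larger disjunction, the
  latter brings it down to another pair of formulas. The comparison only concerns formulas, so it
  determines ideals and not sets of worlds; a separation argument then supplies a world in the
  sphere for each formula outside the ideal. Condition (S) quantifies over formulas only, so it too
  can be checked through membership in ideals.\<close>

definition would :: "'w set set \<Rightarrow> 'w set \<Rightarrow> 'w set \<Rightarrow> bool" where
  "would S A B \<longleftrightarrow> \<Union> S \<inter> A = {} \<or> (\<exists>X\<in>S. X \<inter> A \<noteq> {} \<and> X \<inter> A \<subseteq> B)"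

text \<open>The clause is factored through a relation on sets, so that validity of the base axioms
  becomes a matter of three sets and a nested family, and the canonical model can be compared with
  the same relation. Proofs that rely on this form delete \<open>ext.simps(7)\<close>, which would
  unfold it again.\<close>

lemma ext_Would: "ext M (\<phi> \<box>\<rightarrow> \<psi>) = {w \<in> worlds M. would (spheres M w) (ext M \<phi>) (ext M \<psi>)}"
  by (simp add: would_def)

lemma ext_subset_worlds:
  assumes "sphere_model M"
  shows "ext M \<phi> \<subseteq> worlds M"
  using assms by (induction \<phi>) (auto simp: sphere_model_def)

lemma would_refl: "would S A A"
  by (auto simp: would_def)

lemma would_mono: "would S A B \<Longrightarrow> B \<subseteq> B' \<Longrightarrow> would S A B'"
  unfolding would_def by blast

section \<open>Set-theoretic counterparts of (L4), (L2) and (L3) over a nested family\<close>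

context
  fixes S :: "'w set set"
  assumes nested: "\<forall>X\<in>S. \<forall>Y\<in>S. X \<subseteq> Y \<or> Y \<subseteq> X"
begin

lemma would_Int: "would S A (B \<inter> C) \<longleftrightarrow> would S A B \<and> would S A C"
proof
  assume "would S A B \<and> would S A C"
  then show "would S A (B \<inter> C)"
    using nested unfolding would_def by (smt (verit) Int_subset_iff inf_mono order.trans order_refl)
qed (use would_mono in blast)

text \<open>\<open>V\<close> witnesses the conditional from \<open>B\<close> to \<open>A\<close>,
  and \<open>Z\<close> the one from \<open>A\<close> to \<open>B \<inter> C\<close>. Whichever of
  the two lies inside the other witnesses the conditional from \<open>B\<close> to
  \<open>C\<close>.\<close>

lemma would_swap:
  assumes "would S A B" "would S B A" "would S A C"
  shows "would S B C"
proof (cases "\<Union> S \<inter> B = {}")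
  case False
  then obtain V where V: "V \<in> S" "V \<inter> B \<noteq> {}" "V \<inter> B \<subseteq> A"
    using assms(2) by (auto simp: would_def)
  then have "\<Union> S \<inter> A \<noteq> {}" by blast
  moreover have "would S A (B \<inter> C)"
    using assms(1,3) by (simp add: would_Int)
  ultimately obtain Z where Z: "Z \<in> S" "Z \<inter> A \<noteq> {}" "Z \<inter> A \<subseteq> B \<inter> C"
    by (auto simp: would_def)
  show ?thesis
  proof (cases "V \<subseteq> Z")
    case True
    then have "V \<inter> B \<subseteq> C" using V Z by blast
    then show ?thesis using V by (auto simp: would_def)
  next
    case False
    then have "Z \<subseteq> V" using nested V(1) Z(1) by blast
    then have "Z \<inter> B \<noteq> {}" "Z \<inter> B \<subseteq> C" using V Z by blast+
    then show ?thesis using Z(1) by (auto simp: would_def)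
  qed
qed (simp add: would_def)

text \<open>If a sphere met the union but missed one of the two sets, it would witness a conditional
  that is assumed to fail. So every sphere meeting the union meets both sets: a witness for the
  union serves each of them, and the smaller of two separate witnesses serves the union.\<close>

lemma would_Un:
  assumes A: "\<not> would S (A \<union> B) A" and B: "\<not> would S (A \<union> B) B"
  shows "would S (A \<union> B) C \<longleftrightarrow> would S A C \<and> would S B C"
proof -
  have meet: "X \<inter> A \<noteq> {} \<and> X \<inter> B \<noteq> {}" if "X \<in> S" "X \<inter> (A \<union> B) \<noteq> {}" for X
    using that A B unfolding would_def by blast
  show ?thesis
  proof
    assume "would S (A \<union> B) C"
    moreover have "\<Union> S \<inter> (A \<union> B) \<noteq> {}"
      using A by (auto simp: would_def)
    ultimately obtain X where X: "X \<in> S" "X \<inter> (A \<union> B) \<noteq> {}" "X \<inter> (A \<union> B) \<subseteq> C"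
      by (auto simp: would_def)
    with meet[OF X(1,2)] show "would S A C \<and> would S B C"
      unfolding would_def by (auto intro!: bexI[of _ X])
  next
    assume "would S A C \<and> would S B C"
    moreover obtain X0 where "X0 \<in> S" "X0 \<inter> (A \<union> B) \<noteq> {}"
      using A by (auto simp: would_def)
    then have "\<Union> S \<inter> A \<noteq> {}" "\<Union> S \<inter> B \<noteq> {}"
      using meet by blast+
    ultimately obtain X Y where X: "X \<in> S" "X \<inter> A \<noteq> {}" "X \<inter> A \<subseteq> C"
      and Y: "Y \<in> S" "Y \<inter> B \<noteq> {}" "Y \<inter> B \<subseteq> C"
      by (auto simp: would_def)
    from nested X(1) Y(1) have "X \<subseteq> Y \<or> Y \<subseteq> X" by blast
    then show "would S (A \<union> B) C"
    proof
      assume "X \<subseteq> Y"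
      then have "X \<inter> (A \<union> B) \<noteq> {}" "X \<inter> (A \<union> B) \<subseteq> C" using X Y by blast+
      then show ?thesis using X(1) by (auto simp: would_def)
    next
      assume "Y \<subseteq> X"
      then have "Y \<inter> (A \<union> B) \<noteq> {}" "Y \<inter> (A \<union> B) \<subseteq> C" using X Y by blast+
      then show ?thesis using Y(1) by (auto simp: would_def)
    qed
  qed
qed

end

section \<open>Validity of the axioms and rules\<close>

lemma classical_sound: "\<phi> \<in> classical_axioms \<Longrightarrow> w \<in> worlds M \<Longrightarrow> w \<in> ext M \<phi>"
  by (induction rule: classical_axioms.induct) auto

lemma base_sound:
  assumes M: "sphere_model M" and w: "w \<in> worlds M" and "\<phi> \<in> base_axioms"
  shows "w \<in> ext M \<phi>"
proof -
  have nested: "\<forall>X\<in>spheres M w. \<forall>Y\<in>spheres M w. X \<subseteq> Y \<or> Y \<subseteq> X"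
    using M w by (auto simp: sphere_model_def)
  from assms(3) show ?thesis
  proof (induction rule: base_axioms.induct)
    case (classical \<phi>)
    then show ?case using w by (rule classical_sound)
  next
    case (L1 \<phi>)
    then show ?case using w by (simp add: ext_Would would_refl del: ext.simps(7))
  next
    case (L2 \<phi> \<psi> \<gamma>)
    then show ?case
      using w would_swap[OF nested, of "ext M \<phi>" "ext M \<psi>" "ext M \<gamma>"]
        would_swap[OF nested, of "ext M \<psi>" "ext M \<phi>" "ext M \<gamma>"]
      by (auto simp add: ext_Would simp del: ext.simps(7))
  next
    case (L3 \<phi> \<psi> \<gamma>)
    then show ?case
      using w would_Un[OF nested, of "ext M \<phi>" "ext M \<psi>" "ext M \<gamma>"]
      by (auto simp add: ext_Would simp del: ext.simps(7))
  next
    case (L4 \<phi> \<psi> \<gamma>)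
    then show ?case
      using w would_Int[OF nested, of "ext M \<phi>" "ext M \<psi>" "ext M \<gamma>"]
      by (auto simp add: ext_Would simp del: ext.simps(7))
  qed
qed

lemma Union_spheres_subset:
  assumes "sphere_model M" "w \<in> worlds M"
  shows "\<Union> (spheres M w) \<subseteq> worlds M"
  using assms unfolding sphere_model_def by blast

lemma ext_Neg: "ext M (\<^bold>\<not> \<phi>) = worlds M - ext M \<phi>"
  by simp

text \<open>No sphere can meet \<not>\<phi> within \<phi>, so of the clause for the conditional only
  the vacuous case survives.\<close>

lemma ext_Box:
  assumes "sphere_model M"
  shows "ext M (\<box> \<phi>) = {w \<in> worlds M. \<Union> (spheres M w) \<subseteq> ext M \<phi>}"
proof -
  have "\<Union> (spheres M w) \<subseteq> worlds M" if "w \<in> worlds M" for w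
    using Union_spheres_subset[OF assms that] .
  then show ?thesis
    unfolding ext_Would would_def ext_Neg by blast
qed

lemma ext_Diamond:
  assumes M: "sphere_model M"
  shows "ext M (\<diamond> \<phi>) = {w \<in> worlds M. \<Union> (spheres M w) \<inter> ext M \<phi> \<noteq> {}}"
proof -
  have "\<Union> (spheres M w) \<subseteq> worlds M" if "w \<in> worlds M" for w
    using Union_spheres_subset[OF M that] .
  then have "\<Union> (spheres M w) \<subseteq> worlds M - ext M \<phi> \<longleftrightarrow> \<Union> (spheres M w) \<inter> ext M \<phi> = {}"
    if "w \<in> worlds M" for w
    using that by blast
  then show ?thesis
    unfolding ext_Neg[of M "\<box> (\<^bold>\<not> \<phi>)"] ext_Box[OF M] ext_Neg[of M \<phi>] by blast
qed

lemma ext_Preceq_cong: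
  assumes "spheres M w = spheres M u" "w \<in> worlds M" "u \<in> worlds M"
  shows "w \<in> ext M (\<phi> \<^bold>\<preceq> \<psi>) \<longleftrightarrow> u \<in> ext M (\<phi> \<^bold>\<preceq> \<psi>)"
  using assms by simp

lemma instances_sound:
  assumes M: "sphere_model M" and fc: "frame_condition a M" and w: "w \<in> worlds M"
    and \<phi>: "\<phi> \<in> instances a"
  shows "w \<in> ext M \<phi>"
proof (cases a)
  case AxW
  then obtain \<alpha> \<beta> where \<phi>': "\<phi> = (\<alpha> \<box>\<rightarrow> \<beta>) \<^bold>\<rightarrow> (\<alpha> \<^bold>\<rightarrow> \<beta>)" using \<phi> by auto
  have "w \<in> X" if "X \<in> spheres M w" for X
    using that M fc w AxW unfolding sphere_model_def by simp
  moreover have "spheres M w \<noteq> {}" using fc w AxW by auto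
  ultimately have "w \<in> ext M \<beta>" if "w \<in> ext M (\<alpha> \<box>\<rightarrow> \<beta>)" "w \<in> ext M \<alpha>"
    using that unfolding ext_Would would_def by blast
  then show ?thesis using w unfolding \<phi>' ext.simps(4) by blast
next
  case AxC
  then obtain \<alpha> \<beta> where \<phi>': "\<phi> = ((\<alpha> \<box>\<rightarrow> \<beta>) \<^bold>\<rightarrow> (\<alpha> \<^bold>\<rightarrow> \<beta>)) \<^bold>\<and> ((\<alpha> \<^bold>\<and> \<beta>) \<^bold>\<rightarrow> (\<alpha> \<box>\<rightarrow> \<beta>))"
    using \<phi> by auto
  have center: "{w} \<in> spheres M w" using fc w AxC by simp
  have in_all: "w \<in> X" if "X \<in> spheres M w" for X
  proof -
    have "X \<noteq> {}" "X \<subseteq> {w} \<or> {w} \<subseteq> X"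
      using M w that center unfolding sphere_model_def by blast+
    then show ?thesis by blast
  qed
  have "w \<in> ext M \<beta>" if "w \<in> ext M (\<alpha> \<box>\<rightarrow> \<beta>)" "w \<in> ext M \<alpha>"
    using that center in_all unfolding ext_Would would_def by blast
  moreover have "w \<in> ext M (\<alpha> \<box>\<rightarrow> \<beta>)" if "w \<in> ext M \<alpha>" "w \<in> ext M \<beta>"
    using that center w unfolding ext_Would would_def by blast
  ultimately show ?thesis using w unfolding \<phi>' ext.simps(2,4) by blast
next
  case AxN
  then obtain \<psi> where \<psi>: "\<phi> = \<box> \<psi> \<^bold>\<rightarrow> \<diamond> \<psi>" using \<phi> by auto
  have "w \<in> ext M (\<box> \<psi>) \<Longrightarrow> w \<in> ext M (\<diamond> \<psi>)"
    unfolding ext_Box[OF M] ext_Diamond[OF M] using AxN fc w by fastforce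
  then show ?thesis using w unfolding \<psi> ext.simps(4)[of M "\<box> \<psi>"] by blast
next
  case AxT
  then obtain \<psi> where \<psi>: "\<phi> = \<box> \<psi> \<^bold>\<rightarrow> \<psi>" using \<phi> by auto
  have "w \<in> ext M (\<box> \<psi>) \<Longrightarrow> w \<in> ext M \<psi>"
    unfolding ext_Box[OF M] using AxT fc w by fastforce
  then show ?thesis using w unfolding \<psi> ext.simps(4)[of M "\<box> \<psi>"] by blast
next
  case AxS
  then obtain \<alpha> \<beta> where \<phi>': "\<phi> = (\<alpha> \<box>\<rightarrow> \<beta>) \<^bold>\<or> (\<alpha> \<box>\<rightarrow> (\<^bold>\<not> \<beta>))" using \<phi> by auto
  show ?thesis
  proof (cases "\<Union> (spheres M w) \<inter> ext M \<alpha> = {}")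
    case True
    then show ?thesis using w by (auto simp: \<phi>')
  next
    case False
    then obtain X y where X: "X \<in> spheres M w" "ext M \<alpha> \<inter> X = {y}"
      using fc AxS w by (metis frame_condition.simps(5) inf_commute)
    \<comment> \<open>Negation is complement within the set of worlds, so the single \<alpha>-world
      \<open>y\<close> decides \<beta> only once it is known to be a world.\<close>
    then have "y \<in> worlds M" using ext_subset_worlds[OF M, of \<alpha>] by blast
    moreover have "X \<inter> ext M \<alpha> = {y}" using X by blast
    ultimately have "X \<inter> ext M \<alpha> \<noteq> {} \<and>
        (X \<inter> ext M \<alpha> \<subseteq> ext M \<beta> \<or> X \<inter> ext M \<alpha> \<subseteq> ext M (\<^bold>\<not> \<beta>))"
      by auto
    then have "would (spheres M w) (ext M \<alpha>) (ext M \<beta>) \<or>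
        would (spheres M w) (ext M \<alpha>) (ext M (\<^bold>\<not> \<beta>))"
      using X(1) unfolding would_def by auto
    then show ?thesis using w unfolding \<phi>' ext.simps(3) ext_Would by blast
  qed
next
  case AxU
  then obtain \<psi> where \<psi>: "\<phi> = (\<diamond> \<psi> \<^bold>\<rightarrow> \<box> (\<diamond> \<psi>)) \<^bold>\<and> (\<box> \<psi> \<^bold>\<rightarrow> \<box> (\<box> \<psi>))" using \<phi> by auto
  have eq: "\<And>u. u \<in> worlds M \<Longrightarrow> \<Union> (spheres M u) = \<Union> (spheres M w)"
    using fc w unfolding AxU frame_condition.simps by blast
  have sub: "\<Union> (spheres M w) \<subseteq> worlds M"
    using Union_spheres_subset[OF M w] .
  have 1: "w \<in> ext M (\<diamond> \<psi>) \<Longrightarrow> w \<in> ext M (\<box> (\<diamond> \<psi>))"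
    unfolding ext_Box[OF M] ext_Diamond[OF M] using eq sub by blast
  have 2: "w \<in> ext M (\<box> \<psi>) \<Longrightarrow> w \<in> ext M (\<box> (\<box> \<psi>))"
    unfolding ext_Box[OF M] using eq sub by blast
  show ?thesis using w 1 2 unfolding \<psi> ext.simps(2) ext.simps(4)[of M "\<diamond> \<psi>"]
      ext.simps(4)[of M "\<box> \<psi>" "\<box> (\<box> \<psi>)"] by blast
next
  case AxA
  then obtain \<alpha> \<beta> where \<phi>': "\<phi> = ((\<alpha> \<^bold>\<preceq> \<beta>) \<^bold>\<rightarrow> \<box> (\<alpha> \<^bold>\<preceq> \<beta>)) \<^bold>\<and> ((\<alpha> \<^bold>\<prec> \<beta>) \<^bold>\<rightarrow> \<box> (\<alpha> \<^bold>\<prec> \<beta>))"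
    using \<phi> by auto
  have sub: "\<Union> (spheres M w) \<subseteq> worlds M"
    using Union_spheres_subset[OF M w] .
  have eq: "w \<in> ext M (\<gamma> \<^bold>\<preceq> \<delta>) \<longleftrightarrow> u \<in> ext M (\<gamma> \<^bold>\<preceq> \<delta>)" if "u \<in> worlds M" for u \<gamma> \<delta>
    using fc w that unfolding AxA frame_condition.simps by (intro ext_Preceq_cong) blast+
  have 1: "w \<in> ext M (\<alpha> \<^bold>\<preceq> \<beta>) \<Longrightarrow> w \<in> ext M (\<box> (\<alpha> \<^bold>\<preceq> \<beta>))"
    unfolding ext_Box[OF M] using eq sub w by blast
  have 2: "w \<in> ext M (\<alpha> \<^bold>\<prec> \<beta>) \<Longrightarrow> w \<in> ext M (\<box> (\<alpha> \<^bold>\<prec> \<beta>))"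
    unfolding ext_Box[OF M] ext_Neg[of M "\<beta> \<^bold>\<preceq> \<alpha>"] using eq[of _ \<beta> \<alpha>] sub w by blast
  show ?thesis using w 1 2 unfolding \<phi>' ext.simps(2) ext.simps(4)[of M "\<alpha> \<^bold>\<preceq> \<beta>"]
      ext.simps(4)[of M "\<alpha> \<^bold>\<prec> \<beta>" "\<box> (\<alpha> \<^bold>\<prec> \<beta>)"] by blast
qed

lemma axioms_sound:
  assumes "M \<in> K \<Sigma>" "\<phi> \<in> axioms_of \<Sigma>" "w \<in> worlds M"
  shows "w \<in> ext M \<phi>"
proof -
  have M: "sphere_model M" "\<And>a. a \<in> \<Sigma> \<Longrightarrow> frame_condition a M"
    using assms(1) by (simp_all add: K_def)
  from assms(2) consider "\<phi> \<in> base_axioms" | a where "a \<in> \<Sigma>" "\<phi> \<in> instances a"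
    by (auto simp: axioms_of_def)
  then show ?thesis
    by cases (use M assms(3) base_sound instances_sound in metis)+
qed

text \<open>The implication is required at all worlds, because spheres may contain worlds other than
  the one of evaluation. Hence (C) preserves global truth, whereas local consequence admits it for
  theorems only.\<close>

lemma rule_C_sound:
  assumes "worlds M \<subseteq> ext M (\<phi> \<^bold>\<rightarrow> \<psi>)" "sphere_model M"
  shows "worlds M \<subseteq> ext M ((\<gamma> \<box>\<rightarrow> \<phi>) \<^bold>\<rightarrow> (\<gamma> \<box>\<rightarrow> \<psi>))"
proof -
  have "ext M \<phi> \<subseteq> ext M \<psi>"
    using assms(1) ext_subset_worlds[OF assms(2), of \<phi>] by auto
  then show ?thesis
    using would_mono by (fastforce simp: ext_Would simp del: ext.simps(7))
qed

lemma GV_sound: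
  fixes \<phi> :: "'p form"
  assumes "GV \<Sigma> \<Gamma> \<phi>"
  shows "global_consequence (K \<Sigma> :: ('w, 'p) model set) \<Gamma> \<phi>"
proof -
  have "worlds M \<subseteq> ext M \<phi>" if M: "M \<in> K \<Sigma>" and \<Gamma>: "\<forall>\<gamma>\<in>\<Gamma>. worlds M \<subseteq> ext M \<gamma>"
    for M :: "('w, 'p) model"
    using assms
  proof induction
    case (ax \<phi>)
    then show ?case using axioms_sound[OF M] by (simp add: subsetI)
  next
    case (C \<phi> \<psi> \<gamma>)
    from rule_C_sound[OF C.IH] M show ?case by (simp add: K_def del: ext.simps)
  next
    case (mp \<phi> \<psi>)
    then show ?case unfolding ext.simps(4) by blast
  qed (use \<Gamma> in blast)
  then show ?thesis unfolding global_consequence_def by blast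
qed

lemma LV_sound:
  fixes \<phi> :: "'p form"
  assumes "LV \<Sigma> \<Gamma> \<phi>"
  shows "local_consequence (K \<Sigma> :: ('w, 'p) model set) \<Gamma> \<phi>"
  using assms
proof induction
  case (ax \<phi> \<Gamma>)
  then show ?case by (auto simp: local_consequence_def simp del: ext.simps intro: axioms_sound)
next
  case (wC \<phi> \<psi> \<Gamma> \<gamma>)
  have "w \<in> ext M ((\<gamma> \<box>\<rightarrow> \<phi>) \<^bold>\<rightarrow> (\<gamma> \<box>\<rightarrow> \<psi>))"
    if M: "M \<in> K \<Sigma>" and "w \<in> worlds M" for M :: "('w, 'p) model" and w
  proof -
    have "worlds M \<subseteq> ext M (\<phi> \<^bold>\<rightarrow> \<psi>)"
      using wC.IH M by (simp add: local_consequence_def subsetI del: ext.simps)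
    from rule_C_sound[OF this] that show ?thesis by (auto simp: K_def simp del: ext.simps)
  qed
  then show ?case by (simp add: local_consequence_def del: ext.simps)
qed (auto simp: local_consequence_def)


section \<open>Maximal consistent sets\<close>

text \<open>\<open>T\<close> abstracts from the two logics. For \<open>GV\<close> it is instantiated
  by the consequences of \<Gamma>, which are closed under (C), so that \<Gamma> holds at every
  world; for \<open>LV\<close> by the theorems, so that only the root has to contain
  \<Gamma>.\<close>

locale closed_theory =
  fixes \<Sigma> :: "extra_axiom set" and T :: "'p form set"
  assumes axioms: "axioms_of \<Sigma> \<subseteq> T"
    and T_mp: "\<phi> \<^bold>\<rightarrow> \<psi> \<in> T \<Longrightarrow> \<phi> \<in> T \<Longrightarrow> \<psi> \<in> T"
    and T_C: "\<phi> \<^bold>\<rightarrow> \<psi> \<in> T \<Longrightarrow> (\<gamma> \<box>\<rightarrow> \<phi>) \<^bold>\<rightarrow> (\<gamma> \<box>\<rightarrow> \<psi>) \<in> T"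
begin

lemma classical_in_T: "\<phi> \<in> classical_axioms \<Longrightarrow> \<phi> \<in> T"
  using axioms by (auto simp: axioms_of_def intro: base_axioms.classical)

lemma base_in_T: "\<phi> \<in> base_axioms \<Longrightarrow> \<phi> \<in> T"
  using axioms by (auto simp: axioms_of_def)

text \<open>Closure under (C) is left to \<open>T\<close>: a world records local truth, which the
  rule need not preserve.\<close>

definition deductive :: "'p form set \<Rightarrow> bool" where
  "deductive D \<longleftrightarrow> T \<subseteq> D \<and> (\<forall>\<phi> \<psi>. \<phi> \<^bold>\<rightarrow> \<psi> \<in> D \<longrightarrow> \<phi> \<in> D \<longrightarrow> \<psi> \<in> D)"

lemma deductive_mp: "deductive D \<Longrightarrow> \<phi> \<^bold>\<rightarrow> \<psi> \<in> D \<Longrightarrow> \<phi> \<in> D \<Longrightarrow> \<psi> \<in> D"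
  by (auto simp: deductive_def)

lemma deductive_ax: "deductive D \<Longrightarrow> \<phi> \<in> classical_axioms \<Longrightarrow> \<phi> \<in> D"
  using classical_in_T by (auto simp: deductive_def)

lemma deductive_T: "deductive T"
  using T_mp by (auto simp: deductive_def)

lemma deductive_K: "deductive D \<Longrightarrow> \<psi> \<in> D \<Longrightarrow> \<phi> \<^bold>\<rightarrow> \<psi> \<in> D"
  by (rule deductive_mp[OF _ deductive_ax[OF _ classical_axioms.intros(1)]])

lemma deductive_S:
  "deductive D \<Longrightarrow> \<phi> \<^bold>\<rightarrow> (\<psi> \<^bold>\<rightarrow> \<gamma>) \<in> D \<Longrightarrow> \<phi> \<^bold>\<rightarrow> \<psi> \<in> D \<Longrightarrow> \<phi> \<^bold>\<rightarrow> \<gamma> \<in> D"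
  by (rule deductive_mp[OF _ deductive_mp[OF _ deductive_ax[OF _ classical_axioms.intros(2)]]])

text \<open>The deduction theorem turned into a definition: for deductive \<open>D\<close> this is
  the least deductive set containing \<open>D\<close> and \<alpha>.\<close>

definition adjoin :: "'p form set \<Rightarrow> 'p form \<Rightarrow> 'p form set" where
  "adjoin D \<alpha> = {\<chi>. \<alpha> \<^bold>\<rightarrow> \<chi> \<in> D}"

lemma adjoin:
  assumes D: "deductive D"
  shows "deductive (adjoin D \<alpha>)" "D \<subseteq> adjoin D \<alpha>" "\<alpha> \<in> adjoin D \<alpha>"
proof -
  show sub: "D \<subseteq> adjoin D \<alpha>"
    using deductive_K[OF D] by (auto simp: adjoin_def)
  show "deductive (adjoin D \<alpha>)"
    using sub D deductive_S[OF D] unfolding deductive_def adjoin_def by blast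
  show "\<alpha> \<in> adjoin D \<alpha>"
    unfolding adjoin_def mem_Collect_eq
    by (rule deductive_S[OF D, of \<alpha> "\<alpha> \<^bold>\<rightarrow> \<alpha>"]) (intro deductive_ax[OF D] classical_axioms.intros)+
qed

lemma adjoin_Neg_consistent:
  assumes D: "deductive D" and "\<alpha> \<notin> D"
  shows "\<^bold>0 \<notin> adjoin D (\<^bold>\<not> \<alpha>)"
  using assms(2) deductive_mp[OF D deductive_ax[OF D classical_axioms.intros(11)[of \<alpha>]]]
  by (auto simp: adjoin_def)

definition mcs :: "'p form set \<Rightarrow> bool" where
  "mcs w \<longleftrightarrow> deductive w \<and> \<^bold>0 \<notin> w \<and> (\<forall>\<phi>. \<phi> \<in> w \<or> \<^bold>\<not> \<phi> \<in> w)"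

text \<open>Zorn's lemma replaces the enumeration of formulas, since the type of variables may be
  uncountable.\<close>

lemma lindenbaum:
  assumes D: "deductive D" and "\<^bold>0 \<notin> D"
  obtains w where "mcs w" "D \<subseteq> w"
proof -
  let ?A = "{E. deductive E \<and> \<^bold>0 \<notin> E \<and> D \<subseteq> E}"
  have chains: "\<Union> C \<in> ?A" if C: "C \<noteq> {}" "subset.chain ?A C" for C
  proof -
    have sub: "\<And>E. E \<in> C \<Longrightarrow> E \<in> ?A" using C(2) by (auto simp: subset.chain_def)
    have lin: "\<And>E F. E \<in> C \<Longrightarrow> F \<in> C \<Longrightarrow> E \<subseteq> F \<or> F \<subseteq> E"
      using C(2) by (auto simp: subset.chain_def)
    have "\<psi> \<in> \<Union> C" if imp: "\<phi> \<^bold>\<rightarrow> \<psi> \<in> \<Union> C" "\<phi> \<in> \<Union> C" for \<phi> \<psi>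
    proof -
      obtain E F where "E \<in> C" "\<phi> \<^bold>\<rightarrow> \<psi> \<in> E" "F \<in> C" "\<phi> \<in> F" using imp by blast
      then obtain G where "G \<in> C" "\<phi> \<^bold>\<rightarrow> \<psi> \<in> G" "\<phi> \<in> G" using lin by blast
      then show ?thesis using sub deductive_mp by blast
    qed
    moreover have "T \<subseteq> \<Union> C" "D \<subseteq> \<Union> C" "\<^bold>0 \<notin> \<Union> C"
      using C(1) sub by (fastforce simp: deductive_def)+
    ultimately show ?thesis unfolding deductive_def by blast
  qed
  have "D \<in> ?A" using assms by simp
  then have "?A \<noteq> {}" by blast
  from subset_Zorn_nonempty[OF this chains]
  have "\<exists>w\<in>?A. \<forall>E\<in>?A. w \<subseteq> E \<longrightarrow> E = w" .
  then obtain w where w: "w \<in> ?A" and max: "\<And>E. E \<in> ?A \<Longrightarrow> w \<subseteq> E \<Longrightarrow> E = w"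
    by (elim bexE) simp
  have "\<phi> \<in> w \<or> \<^bold>\<not> \<phi> \<in> w" for \<phi>
  proof (cases "\<^bold>\<not> \<phi> \<in> w")
    case False
    \<comment> \<open>\<not>\<phi> is \<phi> \<rightarrow> 0, so its absence from \<open>w\<close>
      is literally the consistency of adjoining \<phi>.\<close>
    then have "\<^bold>0 \<notin> adjoin w \<phi>" by (simp add: adjoin_def)
    moreover have Dw: "deductive w" "D \<subseteq> w" using w by simp_all
    ultimately have "adjoin w \<phi> = w"
      using adjoin(1,2)[OF Dw(1), of \<phi>] by (intro max) simp_all
    then show ?thesis using adjoin(3)[OF Dw(1), of \<phi>] by simp
  qed simp
  then show ?thesis using w that by (auto simp: mcs_def)
qed

lemma lindenbaum_Neg:
  assumes D: "deductive D" and "\<alpha> \<notin> D"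
  obtains w where "mcs w" "D \<subseteq> w" "\<^bold>\<not> \<alpha> \<in> w"
proof -
  obtain w where w: "mcs w" "adjoin D (\<^bold>\<not> \<alpha>) \<subseteq> w"
    by (rule lindenbaum[OF adjoin(1)[OF D] adjoin_Neg_consistent[OF assms]])
  then have "D \<subseteq> w" "\<^bold>\<not> \<alpha> \<in> w" using adjoin(2,3)[OF D, of "\<^bold>\<not> \<alpha>"] by blast+
  with w(1) show ?thesis by (rule that)
qed

lemma mcs_T: "mcs w \<Longrightarrow> \<phi> \<in> T \<Longrightarrow> \<phi> \<in> w"
  by (auto simp: mcs_def deductive_def)

lemma mcs_Zero: "mcs w \<Longrightarrow> \<^bold>0 \<notin> w"
  by (simp add: mcs_def)

lemma mcs_One: "mcs w \<Longrightarrow> \<^bold>1 \<in> w"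
  using mcs_T classical_in_T classical_axioms.intros(10) by blast

lemma mcs_Impl:
  assumes w: "mcs w"
  shows "\<phi> \<^bold>\<rightarrow> \<psi> \<in> w \<longleftrightarrow> (\<phi> \<in> w \<longrightarrow> \<psi> \<in> w)"
proof -
  have D: "deductive w" using w by (simp add: mcs_def)
  have "\<phi> \<^bold>\<rightarrow> \<psi> \<in> w" if "\<phi> \<notin> w"
  proof -
    have "\<phi> \<^bold>\<rightarrow> (\<^bold>0 \<^bold>\<rightarrow> \<psi>) \<in> w"
      by (intro deductive_K[OF D] deductive_ax[OF D] classical_axioms.intros(9))
    moreover have "\<phi> \<^bold>\<rightarrow> \<^bold>0 \<in> w" using w that unfolding mcs_def by blast
    ultimately show ?thesis by (rule deductive_S[OF D])
  qed
  then show ?thesis using deductive_mp[OF D] deductive_K[OF D] by blast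
qed

lemma mcs_Conj: "mcs w \<Longrightarrow> \<phi> \<^bold>\<and> \<psi> \<in> w \<longleftrightarrow> \<phi> \<in> w \<and> \<psi> \<in> w"
  using mcs_T[OF _ classical_in_T[OF classical_axioms.intros(3)[of \<phi> \<psi>]]]
    mcs_T[OF _ classical_in_T[OF classical_axioms.intros(4)[of \<phi> \<psi>]]]
    mcs_T[OF _ classical_in_T[OF classical_axioms.intros(5)[of \<phi> \<psi>]]]
  by (auto simp: mcs_Impl)

lemma mcs_Disj: "mcs w \<Longrightarrow> \<phi> \<^bold>\<or> \<psi> \<in> w \<longleftrightarrow> \<phi> \<in> w \<or> \<psi> \<in> w"
  using mcs_T[OF _ classical_in_T[OF classical_axioms.intros(6)[of \<phi> \<psi>]]]
    mcs_T[OF _ classical_in_T[OF classical_axioms.intros(7)[of \<psi> \<phi>]]]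
    mcs_T[OF _ classical_in_T[OF classical_axioms.intros(8)[of \<phi> "\<^bold>0" \<psi>]]]
  by (auto simp: mcs_Impl mcs_Zero)

lemmas mcs_simps = mcs_Zero mcs_One mcs_Impl mcs_Conj mcs_Disj

lemma mcs_Neg: "mcs w \<Longrightarrow> \<^bold>\<not> \<phi> \<in> w \<longleftrightarrow> \<phi> \<notin> w"
  by (simp add: mcs_simps)

lemma mcs_ConjD:
  assumes "\<phi> \<^bold>\<and> \<psi> \<in> w" "mcs w"
  shows "\<phi> \<in> w" "\<psi> \<in> w"
  using assms mcs_Conj by blast+

lemma mcs_mp: "mcs w \<Longrightarrow> \<phi> \<^bold>\<rightarrow> \<psi> \<in> w \<Longrightarrow> \<phi> \<in> w \<Longrightarrow> \<psi> \<in> w"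
  by (simp add: mcs_Impl)

lemma mcs_eqI: "mcs w \<Longrightarrow> mcs u \<Longrightarrow> w \<subseteq> u \<Longrightarrow> w = u"
  using mcs_Impl mcs_Zero unfolding mcs_def by blast

text \<open>Phrased through maximal consistent sets, so that a propositional entailment follows by
  \<open>auto\<close> from \<open>mcs_simps\<close> and needs no Hilbert derivation. By
  \<open>entails_imp_T\<close> it amounts to membership of the implication in
  \<open>T\<close>.\<close>

definition entails :: "'p form \<Rightarrow> 'p form \<Rightarrow> bool" where
  "entails \<phi> \<psi> \<longleftrightarrow> (\<forall>u. mcs u \<longrightarrow> \<phi> \<in> u \<longrightarrow> \<psi> \<in> u)"

lemma entails_imp_T:
  assumes "entails \<phi> \<psi>"
  shows "\<phi> \<^bold>\<rightarrow> \<psi> \<in> T"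
proof (rule ccontr)
  assume "\<phi> \<^bold>\<rightarrow> \<psi> \<notin> T"
  then have "\<psi> \<notin> adjoin T \<phi>" by (simp add: adjoin_def)
  then obtain w where w: "mcs w" "adjoin T \<phi> \<subseteq> w" "\<^bold>\<not> \<psi> \<in> w"
    by (rule lindenbaum_Neg[OF adjoin(1)[OF deductive_T]])
  moreover have "\<phi> \<in> w" using w(2) adjoin(3)[OF deductive_T] by blast
  ultimately show False using assms by (auto simp: entails_def mcs_simps)
qed

section \<open>Ideals of formulas and the worlds that avoid them\<close>

definition ideal :: "'p form set \<Rightarrow> bool" where
  "ideal I \<longleftrightarrow> \<^bold>0 \<in> I \<and> (\<forall>\<phi> \<psi>. \<phi> \<in> I \<longrightarrow> \<psi> \<in> I \<longrightarrow> \<phi> \<^bold>\<or> \<psi> \<in> I) \<and>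
     (\<forall>\<phi> \<psi>. \<psi> \<in> I \<longrightarrow> entails \<phi> \<psi> \<longrightarrow> \<phi> \<in> I)"

text \<open>An ideal of formulas is an ideal of the Lindenbaum algebra of \<open>T\<close>, possibly
  improper; this is the closed set of its Stone space that is dual to it.\<close>

definition avoiding :: "'p form set \<Rightarrow> 'p form set set" where
  "avoiding I = {u. mcs u \<and> u \<inter> I = {}}"

text \<open>Separation of \<psi> from the ideal: the theory generated by \<psi> and the negations of
  all members of \<open>I\<close> is consistent, because an inconsistency would make \<psi> entail
  some member of \<open>I\<close>.\<close>

lemma ideal_avoiding:
  assumes I: "ideal I"
  shows "(\<exists>u\<in>avoiding I. \<psi> \<in> u) \<longleftrightarrow> \<psi> \<notin> I"
proof
  assume \<psi>: "\<psi> \<notin> I"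
  \<comment> \<open>This is that theory: \<chi> belongs to it if \<psi> together with the negation
    of one \<open>i\<close> in \<open>I\<close> entails \<chi>. One \<open>i\<close> is enough since
    \<open>I\<close> is closed under disjunction.\<close>
  define D where "D = {\<chi>. \<exists>i\<in>I. entails \<psi> (\<chi> \<^bold>\<or> i)}"
  have "\<psi>'' \<in> D" if "\<psi>' \<^bold>\<rightarrow> \<psi>'' \<in> D" "\<psi>' \<in> D" for \<psi>' \<psi>''
  proof -
    from that obtain i j where ij: "i \<in> I" "j \<in> I"
      and e: "entails \<psi> ((\<psi>' \<^bold>\<rightarrow> \<psi>'') \<^bold>\<or> i)" "entails \<psi> (\<psi>' \<^bold>\<or> j)"
      by (auto simp: D_def)
    from e have "entails \<psi> (\<psi>'' \<^bold>\<or> (i \<^bold>\<or> j))"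
      by (auto simp: entails_def mcs_simps)
    moreover have "i \<^bold>\<or> j \<in> I" using I ij by (simp add: ideal_def)
    ultimately show ?thesis by (auto simp: D_def)
  qed
  moreover have "T \<subseteq> D"
    using I mcs_T unfolding D_def ideal_def by (fastforce simp: entails_def mcs_simps)
  ultimately have "deductive D" unfolding deductive_def by blast
  moreover have "\<^bold>0 \<notin> D"
  proof
    assume "\<^bold>0 \<in> D"
    then obtain i where "i \<in> I" "entails \<psi> i"
      by (auto simp: D_def entails_def mcs_simps)
    then show False using I \<psi> by (auto simp: ideal_def)
  qed
  ultimately obtain w where w: "mcs w" "D \<subseteq> w" using lindenbaum by blast
  have "\<psi> \<in> D"
    using I unfolding D_def ideal_def by (auto simp: entails_def mcs_simps)
  moreover have "i \<notin> w" if "i \<in> I" for i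
  proof -
    have "\<^bold>\<not> i \<in> D" using that unfolding D_def by (auto simp: entails_def mcs_simps)
    then show ?thesis using w by (auto simp: mcs_simps)
  qed
  ultimately show "\<exists>u\<in>avoiding I. \<psi> \<in> u"
    using w unfolding avoiding_def by blast
qed (auto simp: avoiding_def)


section \<open>Conditionals in a maximal consistent set\<close>

context
  fixes w :: "'p form set"
  assumes w: "mcs w"
begin

lemma would_L1: "\<phi> \<box>\<rightarrow> \<phi> \<in> w"
  using mcs_T[OF w] base_in_T base_axioms.L1 by blast

text \<open>Closure of \<open>T\<close> under (C) enters here: an entailment is an implication in
  \<open>T\<close>, so the rule applies to it.\<close>

lemma would_right_mono: "\<gamma> \<box>\<rightarrow> \<phi> \<in> w \<Longrightarrow> entails \<phi> \<psi> \<Longrightarrow> \<gamma> \<box>\<rightarrow> \<psi> \<in> w"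
  using mcs_T[OF w T_C[OF entails_imp_T]] w by (auto simp: mcs_simps)

lemma would_entailed: "entails \<phi> \<psi> \<Longrightarrow> \<phi> \<box>\<rightarrow> \<psi> \<in> w"
  using would_right_mono[OF would_L1] .

lemma would_L2: "\<phi> \<box>\<rightarrow> \<psi> \<in> w \<Longrightarrow> \<psi> \<box>\<rightarrow> \<phi> \<in> w \<Longrightarrow> \<phi> \<box>\<rightarrow> \<gamma> \<in> w \<longleftrightarrow> \<psi> \<box>\<rightarrow> \<gamma> \<in> w"
  using mcs_T[OF w base_in_T[OF base_axioms.L2[of \<phi> \<psi> \<gamma>]]] w by (auto simp: mcs_simps)

lemma would_L3: "(\<phi> \<^bold>\<or> \<psi>) \<box>\<rightarrow> \<phi> \<in> w \<or> (\<phi> \<^bold>\<or> \<psi>) \<box>\<rightarrow> \<psi> \<in> w \<or>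
    ((\<phi> \<^bold>\<or> \<psi>) \<box>\<rightarrow> \<gamma> \<in> w \<longleftrightarrow> \<phi> \<box>\<rightarrow> \<gamma> \<in> w \<and> \<psi> \<box>\<rightarrow> \<gamma> \<in> w)"
  using mcs_T[OF w base_in_T[OF base_axioms.L3[of \<phi> \<psi> \<gamma>]]] w by (auto simp: mcs_simps)

lemma would_L4: "\<phi> \<box>\<rightarrow> \<psi> \<in> w \<Longrightarrow> \<phi> \<box>\<rightarrow> \<gamma> \<in> w \<Longrightarrow> \<phi> \<box>\<rightarrow> (\<psi> \<^bold>\<and> \<gamma>) \<in> w"
  using mcs_T[OF w base_in_T[OF base_axioms.L4[of \<phi> \<psi> \<gamma>]]] w by (auto simp: mcs_simps)

lemma would_conj_entails:
  "\<phi> \<box>\<rightarrow> \<psi> \<in> w \<Longrightarrow> \<phi> \<box>\<rightarrow> \<gamma> \<in> w \<Longrightarrow> entails (\<psi> \<^bold>\<and> \<gamma>) \<delta> \<Longrightarrow> \<phi> \<box>\<rightarrow> \<delta> \<in> w"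
  using would_L4 would_right_mono by blast

lemma would_cong: "entails \<phi> \<psi> \<Longrightarrow> entails \<psi> \<phi> \<Longrightarrow> \<phi> \<box>\<rightarrow> \<gamma> \<in> w \<longleftrightarrow> \<psi> \<box>\<rightarrow> \<gamma> \<in> w"
  using would_L2 would_entailed by blast

lemma would_Zero_antimono:
  assumes "entails \<psi> \<phi>" "\<phi> \<box>\<rightarrow> \<^bold>0 \<in> w"
  shows "\<psi> \<box>\<rightarrow> \<^bold>0 \<in> w"
proof -
  have "\<phi> \<box>\<rightarrow> \<psi> \<in> w"
    by (rule would_right_mono[OF assms(2)]) (simp add: entails_def mcs_simps)
  then show ?thesis using would_L2[of \<phi> \<psi>] would_entailed[OF assms(1)] assms(2) by blast
qed

text \<open>In the first two cases of (L3) the disjunction and one disjunct are interchangeable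
  antecedents by (L2); the third case is the claim.\<close>

lemma would_DisjI:
  assumes "\<phi> \<box>\<rightarrow> \<gamma> \<in> w" "\<psi> \<box>\<rightarrow> \<gamma> \<in> w"
  shows "(\<phi> \<^bold>\<or> \<psi>) \<box>\<rightarrow> \<gamma> \<in> w"
proof -
  have "\<phi> \<box>\<rightarrow> (\<phi> \<^bold>\<or> \<psi>) \<in> w" "\<psi> \<box>\<rightarrow> (\<phi> \<^bold>\<or> \<psi>) \<in> w"
    by (auto intro!: would_entailed simp: entails_def mcs_simps)
  then show ?thesis using would_L3[of \<phi> \<psi> \<gamma>] would_L2 assms by blast
qed

text \<open>Conditionalization, known from preferential consequence: \<phi> splits into \<psi> and
  \<phi> \<and> \<not>\<psi>, and the material implication follows conditionally from either
  part.\<close>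

lemma would_conditionalize:
  assumes "\<psi> \<box>\<rightarrow> \<gamma> \<in> w" "entails \<psi> \<phi>"
  shows "\<phi> \<box>\<rightarrow> (\<psi> \<^bold>\<rightarrow> \<gamma>) \<in> w"
proof -
  have "\<psi> \<box>\<rightarrow> (\<psi> \<^bold>\<rightarrow> \<gamma>) \<in> w"
    by (rule would_right_mono[OF assms(1)]) (auto simp: entails_def mcs_simps)
  moreover have "(\<phi> \<^bold>\<and> \<^bold>\<not> \<psi>) \<box>\<rightarrow> (\<psi> \<^bold>\<rightarrow> \<gamma>) \<in> w"
    by (rule would_entailed) (auto simp: entails_def mcs_simps)
  ultimately have "(\<psi> \<^bold>\<or> (\<phi> \<^bold>\<and> \<^bold>\<not> \<psi>)) \<box>\<rightarrow> (\<psi> \<^bold>\<rightarrow> \<gamma>) \<in> w"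
    by (rule would_DisjI)
  moreover have "entails (\<psi> \<^bold>\<or> (\<phi> \<^bold>\<and> \<^bold>\<not> \<psi>)) \<phi>" "entails \<phi> (\<psi> \<^bold>\<or> (\<phi> \<^bold>\<and> \<^bold>\<not> \<psi>))"
    using assms(2) by (auto simp: entails_def mcs_simps)
  ultimately show ?thesis using would_cong by blast
qed

text \<open>(L3) is applied to the splitting of \<phi> into \<psi> and \<phi> \<and> \<not>\<psi>.
  The last assumption excludes that all closest \<phi>-worlds lie in the second part; if they all
  lie in the first, (L2) exchanges \<phi> and \<psi>.\<close>

lemma rational_monotonicity:
  assumes "\<phi> \<box>\<rightarrow> \<gamma> \<in> w" "entails \<psi> \<phi>" "\<phi> \<box>\<rightarrow> \<^bold>\<not> \<psi> \<notin> w"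
  shows "\<psi> \<box>\<rightarrow> \<gamma> \<in> w"
proof -
  let ?d = "\<psi> \<^bold>\<or> (\<phi> \<^bold>\<and> \<^bold>\<not> \<psi>)"
  have "entails ?d \<phi>" "entails \<phi> ?d"
    using assms(2) by (auto simp: entails_def mcs_simps)
  then have cong: "?d \<box>\<rightarrow> \<chi> \<in> w \<longleftrightarrow> \<phi> \<box>\<rightarrow> \<chi> \<in> w" for \<chi>
    by (rule would_cong)
  have "\<phi> \<box>\<rightarrow> (\<phi> \<^bold>\<and> \<^bold>\<not> \<psi>) \<notin> w"
    using assms(3) would_right_mono[of \<phi> "\<phi> \<^bold>\<and> \<^bold>\<not> \<psi>" "\<^bold>\<not> \<psi>"] by (auto simp: entails_def mcs_simps)
  then have "\<phi> \<box>\<rightarrow> \<psi> \<in> w \<or> \<psi> \<box>\<rightarrow> \<gamma> \<in> w"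
    using would_L3[of \<psi> "\<phi> \<^bold>\<and> \<^bold>\<not> \<psi>" \<gamma>] assms(1) by (auto simp: cong)
  then show ?thesis
    using would_L2[of \<phi> \<psi> \<gamma>] would_entailed[OF assms(2)] assms(1) by blast
qed

end

section \<open>The ideals of impossible and of strictly less possible formulas\<close>

definition impossible :: "'p form set \<Rightarrow> 'p form set" where
  "impossible w = {\<chi>. \<chi> \<box>\<rightarrow> \<^bold>0 \<in> w}"

text \<open>For possible \<phi> this is the failure of \<chi> \<preceq> \<phi>, as
  \<open>beyond_Preceq\<close> confirms. The conditional form is the one to which (L2),
  conditionalization and rational monotonicity apply.\<close>

definition beyond :: "'p form set \<Rightarrow> 'p form \<Rightarrow> 'p form set" where
  "beyond w \<phi> = {\<chi>. (\<phi> \<^bold>\<or> \<chi>) \<box>\<rightarrow> \<^bold>\<not> \<chi> \<in> w}"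

context
  fixes w :: "'p form set"
  assumes w: "mcs w"
begin

lemma ideal_impossible: "ideal (impossible w)"
  unfolding ideal_def impossible_def
  using would_L1[OF w] would_DisjI[OF w] would_Zero_antimono[OF w] by blast

lemma impossible_antimono: "\<psi> \<in> impossible w \<Longrightarrow> entails \<phi> \<psi> \<Longrightarrow> \<phi> \<in> impossible w"
  using ideal_impossible unfolding ideal_def by blast

lemma impossible_DisjD: "\<phi> \<^bold>\<or> \<psi> \<in> impossible w \<Longrightarrow> \<phi> \<in> impossible w"
  by (erule impossible_antimono) (simp add: entails_def mcs_simps)

lemma would_Neg_self: "\<phi> \<box>\<rightarrow> \<^bold>\<not> \<phi> \<in> w \<longleftrightarrow> \<phi> \<in> impossible w"
proof
  assume "\<phi> \<box>\<rightarrow> \<^bold>\<not> \<phi> \<in> w"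
  then show "\<phi> \<in> impossible w"
    unfolding impossible_def mem_Collect_eq
    by (rule would_conj_entails[OF w _ would_L1[OF w]]) (auto simp: entails_def mcs_simps)
next
  assume "\<phi> \<in> impossible w"
  then show "\<phi> \<box>\<rightarrow> \<^bold>\<not> \<phi> \<in> w"
    unfolding impossible_def mem_Collect_eq
    by (rule would_right_mono[OF w]) (auto simp: entails_def mcs_simps)
qed

lemma Box_in_iff: "\<box> \<phi> \<in> w \<longleftrightarrow> \<^bold>\<not> \<phi> \<in> impossible w"
proof -
  have "\<box> \<phi> \<in> w \<longleftrightarrow> (\<^bold>\<not> \<phi>) \<box>\<rightarrow> \<^bold>\<not> (\<^bold>\<not> \<phi>) \<in> w"
    using would_right_mono[OF w, of "\<^bold>\<not> \<phi>" \<phi> "\<^bold>\<not> (\<^bold>\<not> \<phi>)"]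
      would_right_mono[OF w, of "\<^bold>\<not> \<phi>" "\<^bold>\<not> (\<^bold>\<not> \<phi>)" \<phi>]
    by (auto simp: entails_def mcs_simps)
  then show ?thesis by (simp add: would_Neg_self)
qed

lemma impossible_cong: "entails \<phi> \<psi> \<Longrightarrow> entails \<psi> \<phi> \<Longrightarrow> \<phi> \<in> impossible w \<longleftrightarrow> \<psi> \<in> impossible w"
  unfolding impossible_def mem_Collect_eq by (rule would_cong[OF w])

lemma Box_Neg_in_iff: "\<box> (\<^bold>\<not> \<phi>) \<in> w \<longleftrightarrow> \<phi> \<in> impossible w"
  unfolding Box_in_iff by (rule impossible_cong) (auto simp: entails_def mcs_simps)

lemma beyond_self: "\<phi> \<in> beyond w \<phi> \<longleftrightarrow> \<phi> \<in> impossible w"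
proof -
  have "\<phi> \<in> beyond w \<phi> \<longleftrightarrow> \<phi> \<box>\<rightarrow> \<^bold>\<not> \<phi> \<in> w"
    unfolding beyond_def mem_Collect_eq
    by (rule would_cong[OF w]) (auto simp: entails_def mcs_simps)
  then show ?thesis by (simp add: would_Neg_self)
qed

text \<open>Closest \<phi> \<or> \<chi>-worlds that refute \<chi> satisfy \<phi>, so (L2) makes
  \<phi> and \<phi> \<or> \<chi> interchangeable. With the converse \<open>beyondI\<close>,
  membership splits into two conditions that can be handled separately.\<close>

lemma beyondD:
  assumes "\<chi> \<in> beyond w \<phi>"
  shows "(\<phi> \<^bold>\<or> \<chi>) \<box>\<rightarrow> \<phi> \<in> w" "\<phi> \<box>\<rightarrow> \<^bold>\<not> \<chi> \<in> w"
proof -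
  have 1: "(\<phi> \<^bold>\<or> \<chi>) \<box>\<rightarrow> \<^bold>\<not> \<chi> \<in> w" using assms by (simp add: beyond_def)
  show 2: "(\<phi> \<^bold>\<or> \<chi>) \<box>\<rightarrow> \<phi> \<in> w"
    by (rule would_conj_entails[OF w 1 would_L1[OF w]]) (auto simp: entails_def mcs_simps)
  have "\<phi> \<box>\<rightarrow> (\<phi> \<^bold>\<or> \<chi>) \<in> w"
    by (rule would_entailed[OF w]) (auto simp: entails_def mcs_simps)
  with 1 2 show "\<phi> \<box>\<rightarrow> \<^bold>\<not> \<chi> \<in> w" using would_L2[OF w] by blast
qed

lemma beyondI:
  assumes "(\<phi> \<^bold>\<or> \<chi>) \<box>\<rightarrow> \<phi> \<in> w" "\<phi> \<box>\<rightarrow> \<^bold>\<not> \<chi> \<in> w"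
  shows "\<chi> \<in> beyond w \<phi>"
proof -
  have "\<phi> \<box>\<rightarrow> (\<phi> \<^bold>\<or> \<chi>) \<in> w"
    by (rule would_entailed[OF w]) (auto simp: entails_def mcs_simps)
  with assms show ?thesis using would_L2[OF w] unfolding beyond_def by blast
qed

text \<open>Makes the ideal of impossible formulas the least level, so that its sphere is the
  largest.\<close>

lemma impossible_subset_beyond: "impossible w \<subseteq> beyond w \<phi>"
proof
  fix \<chi> assume \<chi>: "\<chi> \<in> impossible w"
  then have "\<chi> \<box>\<rightarrow> \<phi> \<in> w"
    unfolding impossible_def mem_Collect_eq
    by (rule would_right_mono[OF w]) (auto simp: entails_def mcs_simps)
  with would_L1[OF w] have 1: "(\<phi> \<^bold>\<or> \<chi>) \<box>\<rightarrow> \<phi> \<in> w" by (rule would_DisjI[OF w])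
  have "(\<phi> \<^bold>\<and> \<chi>) \<box>\<rightarrow> \<^bold>0 \<in> w"
    using would_Zero_antimono[OF w, of "\<phi> \<^bold>\<and> \<chi>" \<chi>] \<chi>
    by (auto simp: impossible_def entails_def mcs_simps)
  then have "\<phi> \<box>\<rightarrow> ((\<phi> \<^bold>\<and> \<chi>) \<^bold>\<rightarrow> \<^bold>0) \<in> w"
    by (rule would_conditionalize[OF w]) (auto simp: entails_def mcs_simps)
  then have "\<phi> \<box>\<rightarrow> \<^bold>\<not> \<chi> \<in> w"
    by (rule would_conj_entails[OF w _ would_L1[OF w]]) (auto simp: entails_def mcs_simps)
  with 1 show "\<chi> \<in> beyond w \<phi>" by (rule beyondI)
qed

text \<open>Joins are treated through the two conditions of \<open>beyondD\<close>. For downward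
  closure, the closest \<phi> \<or> \<chi>-worlds satisfy \<phi>, so (L2) allows the smaller \<chi>'
  in place of \<chi> in the antecedent.\<close>

lemma ideal_beyond: "ideal (beyond w \<phi>)"
  unfolding ideal_def
proof (intro conjI allI impI)
  show "\<^bold>0 \<in> beyond w \<phi>"
    using impossible_subset_beyond ideal_impossible by (auto simp: ideal_def)
next
  fix \<chi> \<chi>' assume 1: "\<chi> \<in> beyond w \<phi>" and 2: "\<chi>' \<in> beyond w \<phi>"
  have "((\<phi> \<^bold>\<or> \<chi>) \<^bold>\<or> (\<phi> \<^bold>\<or> \<chi>')) \<box>\<rightarrow> \<phi> \<in> w"
    using beyondD[OF 1] beyondD[OF 2] would_DisjI[OF w] by blast
  then have "(\<phi> \<^bold>\<or> (\<chi> \<^bold>\<or> \<chi>')) \<box>\<rightarrow> \<phi> \<in> w"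
    by (subst would_cong[OF w]) (auto simp: entails_def mcs_simps)
  moreover have "\<phi> \<box>\<rightarrow> \<^bold>\<not> (\<chi> \<^bold>\<or> \<chi>') \<in> w"
    by (rule would_conj_entails[OF w beyondD(2)[OF 1] beyondD(2)[OF 2]])
      (auto simp: entails_def mcs_simps)
  ultimately show "\<chi> \<^bold>\<or> \<chi>' \<in> beyond w \<phi>" by (rule beyondI)
next
  fix \<chi>' \<chi> assume \<chi>: "\<chi> \<in> beyond w \<phi>" and e: "entails \<chi>' \<chi>"
  have "(\<phi> \<^bold>\<or> \<chi>) \<box>\<rightarrow> (\<phi> \<^bold>\<or> \<chi>') \<in> w"
    by (rule would_right_mono[OF w beyondD(1)[OF \<chi>]]) (auto simp: entails_def mcs_simps)
  moreover have "(\<phi> \<^bold>\<or> \<chi>') \<box>\<rightarrow> (\<phi> \<^bold>\<or> \<chi>) \<in> w"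
    using e by (intro would_entailed[OF w]) (auto simp: entails_def mcs_simps)
  moreover have "(\<phi> \<^bold>\<or> \<chi>) \<box>\<rightarrow> \<^bold>\<not> \<chi>' \<in> w"
    using \<chi> e unfolding beyond_def mem_Collect_eq
    by (elim would_right_mono[OF w]) (auto simp: entails_def mcs_simps)
  ultimately show "\<chi>' \<in> beyond w \<phi>"
    unfolding beyond_def using would_L2[OF w] by blast
qed

text \<open>All three formulas are compared inside their disjunction \<open>?s\<close>. Its closest
  worlds refute \<chi> by conditionalization; they refute \<psi> too, since otherwise rational
  monotonicity would put \<chi> beyond \<psi>. A last use of rational monotonicity narrows
  \<open>?s\<close> to \<phi> \<or> \<psi>.\<close>

lemma beyond_trans:
  assumes \<phi>: "\<phi> \<notin> impossible w" and \<chi>: "\<chi> \<in> beyond w \<phi>" and \<psi>: "\<chi> \<notin> beyond w \<psi>"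
  shows "\<psi> \<in> beyond w \<phi>"
proof -
  let ?s = "\<phi> \<^bold>\<or> (\<chi> \<^bold>\<or> \<psi>)"
  have "?s \<box>\<rightarrow> ((\<phi> \<^bold>\<or> \<chi>) \<^bold>\<rightarrow> \<^bold>\<not> \<chi>) \<in> w"
    using \<chi> unfolding beyond_def mem_Collect_eq
    by (rule would_conditionalize[OF w]) (auto simp: entails_def mcs_simps)
  then have 1: "?s \<box>\<rightarrow> \<^bold>\<not> \<chi> \<in> w"
    by (rule would_right_mono[OF w]) (auto simp: entails_def mcs_simps)
  have 2: "?s \<box>\<rightarrow> \<^bold>\<not> (\<psi> \<^bold>\<or> \<chi>) \<in> w"
  proof (rule ccontr)
    assume "?s \<box>\<rightarrow> \<^bold>\<not> (\<psi> \<^bold>\<or> \<chi>) \<notin> w"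
    then have "(\<psi> \<^bold>\<or> \<chi>) \<box>\<rightarrow> \<^bold>\<not> \<chi> \<in> w"
      by (elim rational_monotonicity[OF w 1, rotated]) (auto simp: entails_def mcs_simps)
    then show False using \<psi> by (simp add: beyond_def)
  qed
  \<comment> \<open>Possibility of \<phi> enters here: closest worlds refuting \<phi> as well would
    make \<open>?s\<close> impossible.\<close>
  have 3: "?s \<box>\<rightarrow> \<^bold>\<not> (\<phi> \<^bold>\<or> \<psi>) \<notin> w"
  proof
    assume "?s \<box>\<rightarrow> \<^bold>\<not> (\<phi> \<^bold>\<or> \<psi>) \<in> w"
    then have "?s \<box>\<rightarrow> \<^bold>\<not> ?s \<in> w"
      by (rule would_conj_entails[OF w _ 2]) (auto simp: entails_def mcs_simps)
    then have "?s \<in> impossible w" by (simp add: would_Neg_self)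
    then have "\<phi> \<in> impossible w" by (rule impossible_DisjD)
    then show False using \<phi> by contradiction
  qed
  have "?s \<box>\<rightarrow> \<^bold>\<not> \<psi> \<in> w"
    by (rule would_right_mono[OF w 2]) (auto simp: entails_def mcs_simps)
  then have "(\<phi> \<^bold>\<or> \<psi>) \<box>\<rightarrow> \<^bold>\<not> \<psi> \<in> w"
    by (rule rational_monotonicity[OF w _ _ 3]) (auto simp: entails_def mcs_simps)
  then show ?thesis by (simp add: beyond_def)
qed

lemma beyond_asym:
  assumes "\<phi> \<notin> impossible w" "\<chi> \<in> beyond w \<phi>"
  shows "\<phi> \<notin> beyond w \<chi>"
proof
  assume "\<phi> \<in> beyond w \<chi>"
  have "(\<phi> \<^bold>\<or> \<chi>) \<box>\<rightarrow> \<chi> \<in> w \<longleftrightarrow> (\<chi> \<^bold>\<or> \<phi>) \<box>\<rightarrow> \<chi> \<in> w"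
    by (rule would_cong[OF w]) (auto simp: entails_def mcs_simps)
  then have "(\<phi> \<^bold>\<or> \<chi>) \<box>\<rightarrow> \<chi> \<in> w"
    using beyondD(1)[OF \<open>\<phi> \<in> beyond w \<chi>\<close>] by blast
  moreover have "(\<phi> \<^bold>\<or> \<chi>) \<box>\<rightarrow> \<^bold>\<not> \<chi> \<in> w" using assms(2) by (simp add: beyond_def)
  ultimately have "\<phi> \<^bold>\<or> \<chi> \<in> impossible w"
    unfolding impossible_def mem_Collect_eq
    by (rule would_conj_entails[OF w]) (auto simp: entails_def mcs_simps)
  then show False using impossible_DisjD assms(1) by blast
qed

text \<open>A formula \<xi> beyond \<psi> but not beyond \<phi> forces \<phi> itself beyond \<psi>;
  a second use of \<open>beyond_trans\<close>, with asymmetry, carries along everything beyond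
  \<phi>.\<close>

lemma beyond_linear:
  assumes "\<phi> \<notin> impossible w" "\<psi> \<notin> impossible w"
  shows "beyond w \<phi> \<subseteq> beyond w \<psi> \<or> beyond w \<psi> \<subseteq> beyond w \<phi>"
proof (rule disjCI, rule subsetI)
  fix \<chi> assume "\<not> beyond w \<psi> \<subseteq> beyond w \<phi>" and \<chi>: "\<chi> \<in> beyond w \<phi>"
  then obtain \<xi> where "\<xi> \<in> beyond w \<psi>" "\<xi> \<notin> beyond w \<phi>" by blast
  then have "\<phi> \<in> beyond w \<psi>" using beyond_trans assms by blast
  moreover have "\<phi> \<notin> beyond w \<chi>" using beyond_asym assms(1) \<chi> .
  ultimately show "\<chi> \<in> beyond w \<psi>" using beyond_trans assms by blast
qed

text \<open>A true conditional with possible antecedent is thus witnessed by the sphere of its own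
  antecedent.\<close>

lemma would_beyond: "\<phi> \<box>\<rightarrow> \<psi> \<in> w \<Longrightarrow> \<phi> \<^bold>\<and> \<^bold>\<not> \<psi> \<in> beyond w \<phi>"
proof (rule beyondI)
  assume "\<phi> \<box>\<rightarrow> \<psi> \<in> w"
  then show "\<phi> \<box>\<rightarrow> \<^bold>\<not> (\<phi> \<^bold>\<and> \<^bold>\<not> \<psi>) \<in> w"
    by (rule would_right_mono[OF w]) (auto simp: entails_def mcs_simps)
qed (rule would_entailed[OF w], auto simp: entails_def mcs_simps)

text \<open>The sphere of any \<chi> may serve as witness: conditionalization lifts the assumption
  to \<chi> \<or> \<phi>, and rational monotonicity narrows this to \<phi>, which is permitted
  because \<phi> is not beyond \<chi>.\<close>

lemma beyond_would:
  assumes "\<phi> \<notin> beyond w \<chi>" "\<phi> \<^bold>\<and> \<^bold>\<not> \<psi> \<in> beyond w \<chi>"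
  shows "\<phi> \<box>\<rightarrow> \<psi> \<in> w"
proof -
  let ?d = "\<phi> \<^bold>\<and> \<^bold>\<not> \<psi>"
  have 1: "(\<chi> \<^bold>\<or> \<phi>) \<box>\<rightarrow> ((\<chi> \<^bold>\<or> ?d) \<^bold>\<rightarrow> \<^bold>\<not> ?d) \<in> w"
    using assms(2) unfolding beyond_def mem_Collect_eq
    by (rule would_conditionalize[OF w]) (auto simp: entails_def mcs_simps)
  have 2: "(\<chi> \<^bold>\<or> \<phi>) \<box>\<rightarrow> \<^bold>\<not> \<phi> \<notin> w" using assms(1) by (simp add: beyond_def)
  have "\<phi> \<box>\<rightarrow> ((\<chi> \<^bold>\<or> ?d) \<^bold>\<rightarrow> \<^bold>\<not> ?d) \<in> w"
    by (rule rational_monotonicity[OF w 1 _ 2]) (auto simp: entails_def mcs_simps)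
  then show ?thesis
    by (rule would_conj_entails[OF w _ would_L1[OF w]]) (auto simp: entails_def mcs_simps)
qed

lemma impossible_would:
  assumes "\<phi> \<^bold>\<and> \<^bold>\<not> \<psi> \<in> impossible w"
  shows "\<phi> \<box>\<rightarrow> \<psi> \<in> w"
proof -
  have "\<phi> \<box>\<rightarrow> ((\<phi> \<^bold>\<and> \<^bold>\<not> \<psi>) \<^bold>\<rightarrow> \<^bold>0) \<in> w"
    using assms unfolding impossible_def mem_Collect_eq
    by (rule would_conditionalize[OF w]) (auto simp: entails_def mcs_simps)
  then show ?thesis
    by (rule would_conj_entails[OF w _ would_L1[OF w]]) (auto simp: entails_def mcs_simps)
qed

end


section \<open>The canonical model\<close>

text \<open>The condition on 1 keeps the outermost sphere nonempty: a world that accesses nothing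
  receives no sphere at all. For possible \<phi> the ideal is proper since it omits \<phi>.\<close>

definition levels :: "'p form set \<Rightarrow> 'p form set set" where
  "levels w = beyond w ` (- impossible w) \<union> {I. I = impossible w \<and> \<^bold>1 \<notin> I}"

definition reach :: "('p form set \<times> 'p form set) set" where
  "reach = {(w, u). u \<in> avoiding (impossible w)}"

definition canonical :: "'p form set \<Rightarrow> ('p form set, 'p) model" where
  "canonical w\<^sub>0 = \<lparr>worlds = reach\<^sup>* `` {w\<^sub>0}, spheres = \<lambda>w. avoiding ` levels w,
     val = \<lambda>p. {u \<in> reach\<^sup>* `` {w\<^sub>0}. Var p \<in> u}\<rparr>"

lemma avoiding_antimono: "I \<subseteq> J \<Longrightarrow> avoiding J \<subseteq> avoiding I"
  by (auto simp: avoiding_def)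

context
  fixes w :: "'p form set"
  assumes w: "mcs w"
begin

lemma levelsD:
  assumes "I \<in> levels w"
  shows "ideal I" "impossible w \<subseteq> I" "\<^bold>1 \<notin> I"
proof -
  show "ideal I" "impossible w \<subseteq> I"
    using assms ideal_beyond[OF w] ideal_impossible[OF w] impossible_subset_beyond[OF w]
    by (auto simp: levels_def)
  have "\<^bold>1 \<notin> beyond w \<phi>" if "\<phi> \<notin> impossible w" for \<phi>
  proof -
    have "entails \<phi> \<^bold>1" by (simp add: entails_def mcs_simps)
    moreover have "\<phi> \<notin> beyond w \<phi>" using that beyond_self[OF w] by blast
    ultimately show ?thesis using ideal_beyond[OF w, of \<phi>] unfolding ideal_def by blast
  qed
  then show "\<^bold>1 \<notin> I" using assms by (auto simp: levels_def)
qed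

lemma levels_linear:
  assumes "I \<in> levels w" "J \<in> levels w"
  shows "I \<subseteq> J \<or> J \<subseteq> I"
  using assms beyond_linear[OF w] impossible_subset_beyond[OF w] unfolding levels_def by blast

lemma Union_spheres: "\<Union> (avoiding ` levels w) = avoiding (impossible w)"
proof (cases "\<^bold>1 \<in> impossible w")
  case True
  then have "levels w = {}" using levelsD by blast
  then show ?thesis using True mcs_One by (auto simp: avoiding_def)
next
  case False
  then have "impossible w \<in> levels w" by (simp add: levels_def)
  then show ?thesis using avoiding_antimono levelsD(2) by blast
qed

text \<open>By separation, a sphere misses \<phi> iff \<phi> lies in its ideal, and its
  \<phi>-worlds are all \<psi>-worlds iff \<phi> \<and> \<not>\<psi> lies in it. \<open>W\<close>
  stands for the worlds of the generated model; it must contain all accessible worlds for separation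
  to stay inside it.\<close>

lemma would_canonical:
  "\<phi> \<box>\<rightarrow> \<psi> \<in> w \<longleftrightarrow>
     would (avoiding ` levels w) {u \<in> W. \<phi> \<in> u} {u \<in> W. \<psi> \<in> u}"
  if W: "avoiding (impossible w) \<subseteq> W"
proof -
  have mcs: "mcs u" if "u \<in> avoiding I" for u I using that by (simp add: avoiding_def)
  have inW: "avoiding I \<subseteq> W" if "I \<in> levels w" for I
    using avoiding_antimono[OF levelsD(2)[OF that]] W by blast
  have empty: "avoiding I \<inter> {u \<in> W. \<chi> \<in> u} = {} \<longleftrightarrow> \<chi> \<in> I" if "ideal I" "avoiding I \<subseteq> W" for I \<chi>
    using ideal_avoiding[OF that(1), of \<chi>] that(2) by blast
  have sub: "avoiding I \<inter> {u \<in> W. \<phi> \<in> u} \<subseteq> {u \<in> W. \<psi> \<in> u} \<longleftrightarrow> \<phi> \<^bold>\<and> \<^bold>\<not> \<psi> \<in> I"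
    if "I \<in> levels w" for I
    using empty[OF levelsD(1)[OF that] inW[OF that], of "\<phi> \<^bold>\<and> \<^bold>\<not> \<psi>", symmetric] mcs
    by (auto simp: mcs_simps)
  have "would (avoiding ` levels w) {u \<in> W. \<phi> \<in> u} {u \<in> W. \<psi> \<in> u} \<longleftrightarrow>
      \<phi> \<in> impossible w \<or> (\<exists>I\<in>levels w. \<phi> \<notin> I \<and> \<phi> \<^bold>\<and> \<^bold>\<not> \<psi> \<in> I)"
    unfolding would_def Union_spheres empty[OF ideal_impossible[OF w] W] bex_simps
    using sub empty[OF levelsD(1) inW] by auto
  also have "\<dots> \<longleftrightarrow> \<phi> \<box>\<rightarrow> \<psi> \<in> w"
  proof
    assume "\<phi> \<box>\<rightarrow> \<psi> \<in> w"
    then show "\<phi> \<in> impossible w \<or> (\<exists>I\<in>levels w. \<phi> \<notin> I \<and> \<phi> \<^bold>\<and> \<^bold>\<not> \<psi> \<in> I)"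
      using would_beyond[OF w] beyond_self[OF w] unfolding levels_def by blast
  next
    have "\<phi> \<^bold>\<and> \<^bold>\<not> \<psi> \<in> impossible w" if "\<phi> \<in> impossible w"
      using that by (rule impossible_antimono[OF w]) (simp add: entails_def mcs_simps)
    then show "\<phi> \<box>\<rightarrow> \<psi> \<in> w"
      if "\<phi> \<in> impossible w \<or> (\<exists>I\<in>levels w. \<phi> \<notin> I \<and> \<phi> \<^bold>\<and> \<^bold>\<not> \<psi> \<in> I)"
      using that beyond_would[OF w] impossible_would[OF w] unfolding levels_def by blast
  qed
  finally show ?thesis by blast
qed

end

context
  fixes w\<^sub>0 :: "'p form set"
  assumes w0: "mcs w\<^sub>0"
begin

lemma canonical_mcs: "w \<in> worlds (canonical w\<^sub>0) \<Longrightarrow> mcs w"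
proof -
  assume "w \<in> worlds (canonical w\<^sub>0)"
  then have "(w\<^sub>0, w) \<in> reach\<^sup>*" by (simp add: canonical_def)
  then show ?thesis
    by (cases rule: rtranclE) (use w0 in \<open>auto simp: reach_def avoiding_def\<close>)
qed

lemma canonical_reach:
  "w \<in> worlds (canonical w\<^sub>0) \<Longrightarrow> avoiding (impossible w) \<subseteq> worlds (canonical w\<^sub>0)"
  by (auto simp: canonical_def reach_def intro: rtrancl_into_rtrancl)

lemma canonical_spheres: "spheres (canonical w\<^sub>0) w = avoiding ` levels w"
  by (simp add: canonical_def)

lemma truth_lemma: "ext (canonical w\<^sub>0) \<phi> = {w \<in> worlds (canonical w\<^sub>0). \<phi> \<in> w}"
proof (induction \<phi>)
  case (Would \<phi> \<psi>)
  have "\<phi> \<box>\<rightarrow> \<psi> \<in> w \<longleftrightarrow>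
      would (avoiding ` levels w) (ext (canonical w\<^sub>0) \<phi>) (ext (canonical w\<^sub>0) \<psi>)"
    if "w \<in> worlds (canonical w\<^sub>0)" for w
    unfolding Would by (rule would_canonical[OF canonical_mcs canonical_reach]) (rule that)+
  then show ?case unfolding ext_Would canonical_spheres by blast
next
  case (Var p)
  show ?case by (simp add: canonical_def)
next
  case (Conj \<phi> \<psi>)
  then show ?case using mcs_Conj[OF canonical_mcs] by (simp add: set_eq_iff) blast
next
  case (Disj \<phi> \<psi>)
  then show ?case using mcs_Disj[OF canonical_mcs] by (simp add: set_eq_iff) blast
next
  case (Impl \<phi> \<psi>)
  then show ?case using mcs_Impl[OF canonical_mcs] by (simp add: set_eq_iff) blast
next
  case Zero
  show ?case using mcs_Zero[OF canonical_mcs] by simp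
next
  case One
  show ?case using mcs_One[OF canonical_mcs] by auto
qed

lemma sphere_model_canonical: "sphere_model (canonical w\<^sub>0)"
proof -
  have "avoiding I \<noteq> {} \<and> avoiding I \<subseteq> worlds (canonical w\<^sub>0)"
    if u: "u \<in> worlds (canonical w\<^sub>0)" and I: "I \<in> levels u" for u I
  proof -
    note lev = levelsD[OF canonical_mcs[OF u] I]
    have "avoiding I \<noteq> {}" using ideal_avoiding[OF lev(1)] lev(3) by blast
    moreover have "avoiding I \<subseteq> worlds (canonical w\<^sub>0)"
      using avoiding_antimono[OF lev(2)] canonical_reach[OF u] by (rule subset_trans)
    ultimately show ?thesis by blast
  qed
  moreover have "avoiding I \<subseteq> avoiding J \<or> avoiding J \<subseteq> avoiding I"
    if u: "u \<in> worlds (canonical w\<^sub>0)" and "I \<in> levels u" "J \<in> levels u" for u I J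
    using levels_linear[OF canonical_mcs[OF u] that(2,3)] avoiding_antimono by blast
  ultimately show ?thesis
    unfolding sphere_model_def canonical_spheres by (auto simp: canonical_def)
qed

end

section \<open>The frame conditions in the canonical model\<close>

lemma instance_in:
  assumes "a \<in> \<Sigma>" "mcs w" "\<phi> \<in> instances a"
  shows "\<phi> \<in> w"
  using assms axioms mcs_T by (auto simp: axioms_of_def)

lemma W_instances:
  assumes "AxW \<in> \<Sigma> \<or> AxC \<in> \<Sigma>" "mcs w" "\<phi> \<box>\<rightarrow> \<psi> \<in> w" "\<phi> \<in> w"
  shows "\<psi> \<in> w"
proof -
  have "(\<phi> \<box>\<rightarrow> \<psi>) \<^bold>\<rightarrow> (\<phi> \<^bold>\<rightarrow> \<psi>) \<in> w"
    using assms(1)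
  proof
    assume "AxC \<in> \<Sigma>"
    then have "((\<phi> \<box>\<rightarrow> \<psi>) \<^bold>\<rightarrow> (\<phi> \<^bold>\<rightarrow> \<psi>)) \<^bold>\<and> ((\<phi> \<^bold>\<and> \<psi>) \<^bold>\<rightarrow> (\<phi> \<box>\<rightarrow> \<psi>)) \<in> w"
      by (rule instance_in) (auto simp: assms(2))
    then show ?thesis using mcs_Conj[OF assms(2)] by blast
  next
    assume "AxW \<in> \<Sigma>"
    then show ?thesis by (rule instance_in) (auto simp: assms(2))
  qed
  then show ?thesis using assms by (simp add: mcs_simps)
qed

text \<open>If a member \<chi> of \<open>w\<close> were beyond \<phi>, then \<open>w\<close>, being
  a \<phi> \<or> \<chi>-world, would contain \<not>\<chi> by weak centering.\<close>

lemma W_levels: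
  assumes "AxW \<in> \<Sigma> \<or> AxC \<in> \<Sigma>" "mcs w"
  shows "\<^bold>1 \<notin> impossible w" "I \<in> levels w \<Longrightarrow> w \<in> avoiding I"
proof -
  have imp: "\<chi> \<notin> impossible w" if "\<chi> \<in> w" for \<chi>
    using W_instances[OF assms, of \<chi> "\<^bold>0"] that assms(2) by (auto simp: impossible_def mcs_simps)
  then show "\<^bold>1 \<notin> impossible w" using mcs_One assms(2) by blast
  have "\<chi> \<notin> beyond w \<phi>" if "\<chi> \<in> w" for \<chi> \<phi>
    using W_instances[OF assms, of "\<phi> \<^bold>\<or> \<chi>" "\<^bold>\<not> \<chi>"] that assms(2)
    by (auto simp: beyond_def mcs_simps)
  with imp show "w \<in> avoiding I" if "I \<in> levels w"
    using that assms(2) by (auto simp: levels_def avoiding_def)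
qed

text \<open>The sphere of 1 is the witness: the second half of (C) puts 1 \<box>\<rightarrow> \<chi>
  into \<open>w\<close> for each member \<chi>, so every world of that sphere includes
  \<open>w\<close>, hence equals it.\<close>

lemma centered:
  assumes "AxC \<in> \<Sigma>" "mcs w"
  shows "{w} \<in> avoiding ` levels w"
proof -
  have AxC: "AxW \<in> \<Sigma> \<or> AxC \<in> \<Sigma>" using assms(1) by blast
  have lev: "beyond w \<^bold>1 \<in> levels w"
    using W_levels(1)[OF AxC assms(2)] by (auto simp: levels_def)
  have "u = w" if u: "u \<in> avoiding (beyond w \<^bold>1)" for u
  proof -
    have mu: "mcs u" using u by (simp add: avoiding_def)
    have "\<chi> \<in> u" if \<chi>: "\<chi> \<in> w" for \<chi>
    proof -
      have "((\<^bold>1 \<box>\<rightarrow> \<chi>) \<^bold>\<rightarrow> (\<^bold>1 \<^bold>\<rightarrow> \<chi>)) \<^bold>\<and> ((\<^bold>1 \<^bold>\<and> \<chi>) \<^bold>\<rightarrow> (\<^bold>1 \<box>\<rightarrow> \<chi>)) \<in> w"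
        by (rule instance_in[OF assms]) auto
      then have "\<^bold>1 \<box>\<rightarrow> \<chi> \<in> w" using \<chi> assms(2) by (simp add: mcs_simps)
      then have "\<^bold>1 \<^bold>\<and> \<^bold>\<not> \<chi> \<in> beyond w \<^bold>1" by (rule would_beyond[OF assms(2)])
      then have "\<^bold>1 \<^bold>\<and> \<^bold>\<not> \<chi> \<notin> u" using u by (auto simp: avoiding_def)
      then show ?thesis using mu by (simp add: mcs_simps)
    qed
    then show ?thesis using mcs_eqI[OF assms(2) mu] by blast
  qed
  then have "avoiding (beyond w \<^bold>1) = {w}"
    using W_levels(2)[OF AxC assms(2) lev] by blast
  then show ?thesis using lev by (metis imageI)
qed

lemma Preceq_in_iff:
  assumes w: "mcs w"
  shows "\<phi> \<^bold>\<preceq> \<psi> \<in> w \<longleftrightarrow> \<phi> \<^bold>\<or> \<psi> \<in> impossible w \<or> \<phi> \<notin> beyond w \<psi>"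
proof -
  have "(\<phi> \<^bold>\<or> \<psi>) \<box>\<rightarrow> \<^bold>\<not> \<phi> \<in> w \<longleftrightarrow> \<phi> \<in> beyond w \<psi>"
    unfolding beyond_def mem_Collect_eq
    by (rule would_cong[OF w]) (auto simp: entails_def mcs_simps)
  moreover have "(\<phi> \<^bold>\<or> \<psi>) \<box>\<rightarrow> \<^bold>\<not> (\<phi> \<^bold>\<or> \<psi>) \<in> w \<longleftrightarrow> \<phi> \<^bold>\<or> \<psi> \<in> impossible w"
    using would_Neg_self[OF w] .
  ultimately show ?thesis using w by (auto simp: mcs_simps)
qed

text \<open>(A) transports comparisons only, so impossibility too has to be expressed as one; 0 is
  beyond every formula.\<close>

lemma impossible_Preceq:
  assumes w: "mcs w"
  shows "\<phi> \<in> impossible w \<longleftrightarrow> \<^bold>0 \<^bold>\<preceq> \<phi> \<in> w"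
proof -
  have "\<^bold>0 \<in> beyond w \<phi>" using ideal_beyond[OF w] by (simp add: ideal_def)
  moreover have "\<^bold>0 \<^bold>\<or> \<phi> \<in> impossible w \<longleftrightarrow> \<phi> \<in> impossible w"
    by (rule impossible_cong[OF w]) (auto simp: entails_def mcs_simps)
  ultimately show ?thesis using Preceq_in_iff[OF w] by simp
qed

lemma beyond_Preceq:
  assumes w: "mcs w" and "\<psi> \<notin> impossible w"
  shows "\<phi> \<in> beyond w \<psi> \<longleftrightarrow> \<phi> \<^bold>\<preceq> \<psi> \<notin> w"
proof -
  have "\<phi> \<^bold>\<or> \<psi> \<notin> impossible w"
  proof
    assume "\<phi> \<^bold>\<or> \<psi> \<in> impossible w"
    then have "\<psi> \<in> impossible w"
      by (rule impossible_antimono[OF w]) (simp add: entails_def mcs_simps)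
    then show False using assms(2) by contradiction
  qed
  then show ?thesis using Preceq_in_iff[OF w] by simp
qed

lemma reach_Box:
  assumes "(w, u) \<in> reach" "mcs w" "\<box> \<phi> \<in> w"
  shows "\<phi> \<in> u"
proof -
  have "\<^bold>\<not> \<phi> \<in> impossible w" using assms(3) Box_in_iff[OF assms(2)] by blast
  then have "mcs u" "\<^bold>\<not> \<phi> \<notin> u" using assms(1) by (auto simp: reach_def avoiding_def)
  then show ?thesis using mcs_Neg by blast
qed

text \<open>The conjunct of (U) for \<box> carries impossibility forward along accessibility, the
  one for \<diamond> carries possibility; together they give equality.\<close>

lemma reach_impossible_U:
  assumes "AxU \<in> \<Sigma>" and w: "mcs w" and wu: "(w, u) \<in> reach"
  shows "impossible u = impossible w"
proof -
  have u: "mcs u" using wu by (simp add: reach_def avoiding_def)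
  have "\<phi> \<in> impossible u \<longleftrightarrow> \<phi> \<in> impossible w" for \<phi>
  proof -
    have inst: "(\<diamond> \<psi> \<^bold>\<rightarrow> \<box> (\<diamond> \<psi>)) \<^bold>\<and> (\<box> \<psi> \<^bold>\<rightarrow> \<box> (\<box> \<psi>)) \<in> w" for \<psi>
      by (rule instance_in[OF assms(1) w]) auto
    have "\<diamond> \<phi> \<in> w \<Longrightarrow> \<diamond> \<phi> \<in> u"
      by (rule reach_Box[OF wu w mcs_mp[OF w mcs_ConjD(1)[OF inst w]]])
    then have "\<box> (\<^bold>\<not> \<phi>) \<notin> w \<Longrightarrow> \<box> (\<^bold>\<not> \<phi>) \<notin> u"
      unfolding mcs_Neg[OF w] mcs_Neg[OF u] .
    moreover have "\<box> (\<^bold>\<not> \<phi>) \<in> w \<Longrightarrow> \<box> (\<^bold>\<not> \<phi>) \<in> u"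
      by (rule reach_Box[OF wu w mcs_mp[OF w mcs_ConjD(2)[OF inst w]]])
    ultimately show ?thesis using Box_Neg_in_iff[OF w] Box_Neg_in_iff[OF u] by blast
  qed
  then show ?thesis by blast
qed

text \<open>The levels are determined by the comparisons true at a world. The two conjuncts of (A)
  carry both their truth and their failure forward.\<close>

lemma reach_levels_A:
  assumes "AxA \<in> \<Sigma>" and w: "mcs w" and wu: "(w, u) \<in> reach"
  shows "levels u = levels w"
proof -
  have u: "mcs u" using wu by (simp add: reach_def avoiding_def)
  have iff: "\<phi> \<^bold>\<preceq> \<psi> \<in> u \<longleftrightarrow> \<phi> \<^bold>\<preceq> \<psi> \<in> w" for \<phi> \<psi>
  proof -
    have inst: "((\<alpha> \<^bold>\<preceq> \<beta>) \<^bold>\<rightarrow> \<box> (\<alpha> \<^bold>\<preceq> \<beta>)) \<^bold>\<and> ((\<alpha> \<^bold>\<prec> \<beta>) \<^bold>\<rightarrow> \<box> (\<alpha> \<^bold>\<prec> \<beta>)) \<in> w" for \<alpha> \<beta>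
      by (rule instance_in[OF assms(1) w]) auto
    have "\<phi> \<^bold>\<preceq> \<psi> \<in> w \<Longrightarrow> \<phi> \<^bold>\<preceq> \<psi> \<in> u"
      by (rule reach_Box[OF wu w mcs_mp[OF w mcs_ConjD(1)[OF inst w]]])
    moreover have "\<psi> \<^bold>\<prec> \<phi> \<in> w \<Longrightarrow> \<psi> \<^bold>\<prec> \<phi> \<in> u"
      by (rule reach_Box[OF wu w mcs_mp[OF w mcs_ConjD(2)[OF inst w]]])
    then have "\<phi> \<^bold>\<preceq> \<psi> \<notin> w \<Longrightarrow> \<phi> \<^bold>\<preceq> \<psi> \<notin> u"
      unfolding mcs_Neg[OF w, of "\<phi> \<^bold>\<preceq> \<psi>"] mcs_Neg[OF u, of "\<phi> \<^bold>\<preceq> \<psi>"] .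
    ultimately show ?thesis by blast
  qed
  have imp: "impossible u = impossible w"
    using impossible_Preceq[OF u] impossible_Preceq[OF w] iff by blast
  have "beyond u \<phi> = beyond w \<phi>" if "\<phi> \<notin> impossible w" for \<phi>
    using that imp beyond_Preceq[OF u, of \<phi>] beyond_Preceq[OF w, of \<phi>] iff by blast
  then have "beyond u ` (- impossible w) = beyond w ` (- impossible w)"
    by (intro image_cong) simp_all
  then show ?thesis unfolding levels_def imp by simp
qed

context
  fixes w\<^sub>0 :: "'p form set"
  assumes w0: "mcs w\<^sub>0"
begin

lemma reach_invariant:
  assumes "\<And>w u. mcs w \<Longrightarrow> (w, u) \<in> reach \<Longrightarrow> f u = f w"
    and "w \<in> worlds (canonical w\<^sub>0)"
  shows "f w = f w\<^sub>0"
proof -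
  have "(w\<^sub>0, w) \<in> reach\<^sup>*" using assms(2) by (simp add: canonical_def)
  then show ?thesis
  proof induction
    case (step u v)
    then have "mcs u" using canonical_mcs[OF w0] by (simp add: canonical_def)
    then show ?case using assms(1) step by metis
  qed simp
qed

text \<open>Conditional excluded middle lets \<open>w\<close> decide every \<psi> on the assumption
  \<phi>, and all \<phi>-worlds in the sphere of \<phi> obey the decision, so they coincide.\<close>

lemma stalnaker_sphere:
  assumes "AxS \<in> \<Sigma>" and w: "w \<in> worlds (canonical w\<^sub>0)" and \<phi>: "\<phi> \<notin> impossible w"
  shows "\<exists>X\<in>avoiding ` levels w. \<exists>y. ext (canonical w\<^sub>0) \<phi> \<inter> X = {y}"
proof -
  note mw = canonical_mcs[OF w0 w]
  let ?X = "avoiding (beyond w \<phi>)"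
  have lev: "beyond w \<phi> \<in> levels w" using \<phi> by (simp add: levels_def)
  have "?X \<subseteq> worlds (canonical w\<^sub>0)"
    using avoiding_antimono[OF levelsD(2)[OF mw lev]] canonical_reach[OF w0 w] by blast
  then have ext: "ext (canonical w\<^sub>0) \<phi> \<inter> ?X = {u \<in> ?X. \<phi> \<in> u}"
    unfolding truth_lemma[OF w0] by blast
  obtain y where y: "y \<in> ?X" "\<phi> \<in> y"
    using ideal_avoiding[OF ideal_beyond[OF mw]] beyond_self[OF mw] \<phi> by blast
  have my: "mcs y" using y by (simp add: avoiding_def)
  have "u = y" if u: "u \<in> ?X" "\<phi> \<in> u" for u
  proof -
    have mu: "mcs u" using u by (simp add: avoiding_def)
    have *: "\<psi> \<in> v" if "\<phi> \<box>\<rightarrow> \<psi> \<in> w" "v \<in> ?X" "\<phi> \<in> v" for \<psi> v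
    proof -
      have "mcs v" "\<phi> \<^bold>\<and> \<^bold>\<not> \<psi> \<notin> v"
        using that would_beyond[OF mw] by (auto simp: avoiding_def)
      then show ?thesis using that(3) by (simp add: mcs_simps)
    qed
    have "\<psi> \<in> u" if "\<psi> \<in> y" for \<psi>
    proof -
      have "(\<phi> \<box>\<rightarrow> \<psi>) \<^bold>\<or> (\<phi> \<box>\<rightarrow> (\<^bold>\<not> \<psi>)) \<in> w"
        by (rule instance_in[OF assms(1) mw]) auto
      then have "\<phi> \<box>\<rightarrow> \<psi> \<in> w \<or> \<phi> \<box>\<rightarrow> (\<^bold>\<not> \<psi>) \<in> w" using mw by (simp add: mcs_simps)
      \<comment> \<open>Since \<open>y\<close> contains \<psi>, \<open>w\<close> cannot have decided
        for \<not>\<psi>; its decision for \<psi> then binds \<open>u\<close>.\<close>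
      then show ?thesis using *[OF _ u] *[OF _ y, of "\<^bold>\<not> \<psi>"] that my by (auto simp: mcs_simps)
    qed
    then show ?thesis using mcs_eqI[OF my mu] by blast
  qed
  then have "{u \<in> ?X. \<phi> \<in> u} = {y}" using y by blast
  then show ?thesis using ext lev by (metis imageI)
qed

lemma frame_condition_canonical:
  assumes a: "a \<in> \<Sigma>"
  shows "frame_condition a (canonical w\<^sub>0)"
proof -
  let ?W = "worlds (canonical w\<^sub>0)"
  note mcs = canonical_mcs[OF w0]
  note Union = Union_spheres[OF mcs]
  have nonempty: "\<Union> (avoiding ` levels w) \<noteq> {}" if "w \<in> ?W" "\<^bold>1 \<notin> impossible w" for w
    using ideal_avoiding[OF ideal_impossible[OF mcs[OF that(1)]]] that Union[OF that(1)] by blast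
  show ?thesis
  proof (cases a)
    case AxW
    with a have W: "AxW \<in> \<Sigma> \<or> AxC \<in> \<Sigma>" by blast
    have "(\<exists>X\<in>avoiding ` levels w. X \<noteq> {}) \<and> (\<forall>X\<in>avoiding ` levels w. X \<noteq> {} \<longrightarrow> w \<in> X)"
      if "w \<in> ?W" for w
      using W_levels[OF W mcs[OF that]] nonempty[OF that] by blast
    then show ?thesis using AxW by (simp add: canonical_spheres[OF w0])
  next
    case AxC
    then show ?thesis using a centered mcs by (simp add: canonical_spheres[OF w0])
  next
    case AxN
    have "\<^bold>1 \<notin> impossible w" if "w \<in> ?W" for w
    proof -
      note mw = mcs[OF that]
      \<comment> \<open>At 1 the premise of (N) is trivially true, and its conclusion says that 1 is
        possible.\<close>
      have "\<box> \<^bold>1 \<^bold>\<rightarrow> \<diamond> \<^bold>1 \<in> w" by (rule instance_in[OF a mw]) (auto simp: AxN)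
      moreover have "\<box> \<^bold>1 \<in> w"
        by (rule would_entailed[OF mw]) (auto simp: entails_def mcs_simps)
      ultimately have "\<box> (\<^bold>\<not> \<^bold>1) \<notin> w" using mw by (auto simp: mcs_simps)
      then show ?thesis using Box_Neg_in_iff[OF mw] by blast
    qed
    then show ?thesis using AxN nonempty by (simp add: canonical_spheres[OF w0])
  next
    case AxT
    have "w \<in> avoiding (impossible w)" if "w \<in> ?W" for w
    proof -
      note mw = mcs[OF that]
      have "\<chi> \<notin> w" if "\<chi> \<in> impossible w" for \<chi>
      proof -
        have "\<box> (\<^bold>\<not> \<chi>) \<^bold>\<rightarrow> \<^bold>\<not> \<chi> \<in> w" by (rule instance_in[OF a mw]) (auto simp: AxT)
        then show ?thesis using that Box_Neg_in_iff[OF mw, of \<chi>] mw by (simp add: mcs_simps)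
      qed
      then show ?thesis using mw by (auto simp: avoiding_def)
    qed
    then show ?thesis using AxT Union by (simp add: canonical_spheres[OF w0])
  next
    case AxS
    have "\<phi> \<notin> impossible w"
      if "w \<in> ?W" "ext (canonical w\<^sub>0) \<phi> \<inter> \<Union> (avoiding ` levels w) \<noteq> {}" for w \<phi>
      using that(2) unfolding Union[OF that(1)] truth_lemma[OF w0] by (auto simp: avoiding_def)
    then show ?thesis
      using AxS a stalnaker_sphere by (simp add: canonical_spheres[OF w0])
  next
    case AxU
    have "impossible w = impossible w\<^sub>0" if "w \<in> ?W" for w
      using reach_invariant[of impossible] reach_impossible_U a AxU that by blast
    then show ?thesis using AxU Union by (simp add: canonical_spheres[OF w0])
  next
    case AxA
    have "levels w = levels w\<^sub>0" if "w \<in> ?W" for w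
      using reach_invariant[of levels] reach_levels_A a AxA that by blast
    then show ?thesis using AxA by (simp add: canonical_spheres[OF w0])
  qed
qed

lemma canonical_in_K: "canonical w\<^sub>0 \<in> K \<Sigma>"
  using sphere_model_canonical[OF w0] frame_condition_canonical by (simp add: K_def)

lemma canonical_base: "w\<^sub>0 \<in> worlds (canonical w\<^sub>0)"
  by (simp add: canonical_def)

end

end


section \<open>Completeness\<close>

lemma GV_complete:
  fixes \<phi> :: "'p form"
  assumes "global_consequence (K \<Sigma> :: ('p form set, 'p) model set) \<Gamma> \<phi>"
  shows "GV \<Sigma> \<Gamma> \<phi>"
proof (rule ccontr)
  assume "\<not> GV \<Sigma> \<Gamma> \<phi>"
  interpret closed_theory \<Sigma> "{\<chi>. GV \<Sigma> \<Gamma> \<chi>}"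
    by unfold_locales (auto intro: GV.intros)
  from \<open>\<not> GV \<Sigma> \<Gamma> \<phi>\<close> obtain w where w: "mcs w" "\<^bold>\<not> \<phi> \<in> w"
    using lindenbaum_Neg[OF deductive_T, of \<phi>] by blast
  have "\<gamma> \<in> u" if "\<gamma> \<in> \<Gamma>" "u \<in> worlds (canonical w)" for \<gamma> u
    by (rule mcs_T[OF canonical_mcs[OF w(1) that(2)]]) (simp add: GV.hyp that(1))
  then have "\<forall>\<gamma>\<in>\<Gamma>. \<forall>u\<in>worlds (canonical w). u \<in> ext (canonical w) \<gamma>"
    unfolding truth_lemma[OF w(1)] by simp
  with assms canonical_in_K[OF w(1)] canonical_base[OF w(1)]
  have "w \<in> ext (canonical w) \<phi>"
    unfolding global_consequence_def by metis
  then have "\<phi> \<in> w" unfolding truth_lemma[OF w(1)] by simp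
  then show False using w mcs_Neg by blast
qed

text \<open>Needed because the theorems play the part of \<open>T\<close>, while the root must
  extend all consequences of \<Gamma>, which therefore have to include the theorems.\<close>

lemma LV_weaken: "LV \<Sigma> \<Gamma> \<phi> \<Longrightarrow> \<Gamma> \<subseteq> \<Delta> \<Longrightarrow> LV \<Sigma> \<Delta> \<phi>"
  by (induction arbitrary: \<Delta> rule: LV.induct) (auto intro: LV.intros)

lemma LV_complete:
  fixes \<phi> :: "'p form"
  assumes "local_consequence (K \<Sigma> :: ('p form set, 'p) model set) \<Gamma> \<phi>"
  shows "LV \<Sigma> \<Gamma> \<phi>"
proof (rule ccontr)
  assume "\<not> LV \<Sigma> \<Gamma> \<phi>"
  interpret closed_theory \<Sigma> "{\<chi>. LV \<Sigma> {} \<chi>}"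
    by unfold_locales (auto intro: LV.intros)
  let ?D = "{\<chi>. LV \<Sigma> \<Gamma> \<chi>}"
  \<comment> \<open>The consequences of \<Gamma> need not be closed under (C), so they cannot take
    the place of \<open>T\<close>; as a deductive set they still extend to a root.\<close>
  have D: "deductive ?D"
    unfolding deductive_def by (auto intro: LV.mp LV_weaken)
  from \<open>\<not> LV \<Sigma> \<Gamma> \<phi>\<close> have "\<phi> \<notin> ?D" by simp
  then obtain w where w: "mcs w" "?D \<subseteq> w" "\<^bold>\<not> \<phi> \<in> w"
    by (rule lindenbaum_Neg[OF D])
  have "\<gamma> \<in> w" if "\<gamma> \<in> \<Gamma>" for \<gamma>
    using that w(2) LV.hyp by blast
  then have "\<forall>\<gamma>\<in>\<Gamma>. w \<in> ext (canonical w) \<gamma>"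
    using canonical_base[OF w(1)] unfolding truth_lemma[OF w(1)] by simp
  with assms canonical_in_K[OF w(1)] canonical_base[OF w(1)]
  have "w \<in> ext (canonical w) \<phi>"
    unfolding local_consequence_def by metis
  then have "\<phi> \<in> w" unfolding truth_lemma[OF w(1)] by simp
  then show False using w mcs_Neg by blast
qed

theorem theorem5p37:
  fixes \<Sigma> :: "extra_axiom set" and \<Gamma> :: "'p form set" and \<phi> :: "'p form"
  shows "(GV \<Sigma> \<Gamma> \<phi> \<longleftrightarrow> global_consequence (K \<Sigma> :: ('p form set, 'p) model set) \<Gamma> \<phi>) \<and>
         (LV \<Sigma> \<Gamma> \<phi> \<longleftrightarrow> local_consequence (K \<Sigma> :: ('p form set, 'p) model set) \<Gamma> \<phi>) \<and>
         (GV \<Sigma> \<Gamma> \<phi> \<longrightarrow> global_consequence (K \<Sigma> :: ('w, 'p) model set) \<Gamma> \<phi>) \<and>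
         (LV \<Sigma> \<Gamma> \<phi> \<longrightarrow> local_consequence (K \<Sigma> :: ('w, 'p) model set) \<Gamma> \<phi>)"
  by (intro conjI iffI impI) (erule GV_sound GV_complete LV_sound LV_complete)+

end
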